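(* Let $q=3$. Under $G_3$ there are exactly $7$ line orbits, namely: $\mathcal L_1=\{\text{RC-lines}\}$ (size $6$); $\mathcal L_2=\text{En}\Gamma_2$ (size $12$); $\mathcal L_3=\{\text{Tr-lines}\}\cup\text{Un}\Gamma_2$ (size $4+12=16$); $\mathcal L_4=\{\text{IC-lines}\}\cup\{\mathcal A\}\cup\text{EA}_2$ (size $3+1+4=8$); $\mathcal L_5=\{\text{U}\Gamma\text{-lines}\}\cup\text{Un}\Gamma_1$ (size $12+12=24$); $\mathcal L_6=\text{EA}_1\cup\text{En}\Gamma_1$ (size $24+24=48$); $\mathcal L_7=\text{EA}_3\cup\text{En}\Gamma_3$ (size $4+12=16$).
   Context: Notation. $\mathbb F_q$ is the field with $q$ elements, $\mathbb F_q^+=\mathbb F_q\cup\{\infty\}$. Points of $\mathrm{PG}(3,q)$ are written $\mathbf P(x_0,x_1,x_2,x_3)$ with $x$ a nonzero row vector up to scalars; $\boldsymbol\pi(c_0,c_1,c_2,c_3)$ is the plane $c_0x_0+c_1x_1+c_2x_2+c_3x_3=0$. Put $P(t)=\mathbf P(t^3,t^2,t,1)$ for $t\in\mathbb F_q$, $P(\infty)=\mathbf P(1,0,0,0)$, and $\mathscr C=\{P(t):t\in\mathbb F_q^+\}$ (the twisted cubic). The osculating planes are $\pi_{\rm osc}(t)=\boldsymbol\pi(1,-3t,3t^2,-t^3)$ ($t\in\mathbb F_q$) and $\pi_{\rm osc}(\infty)=\boldsymbol\pi(0,0,0,1)$; these $q+1$ planes are called $\Gamma$-planes. The tangent at $P(t)$,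 $t\in\mathbb F_q$, is the line through $P(t)$ and $\mathbf P(3t^2,2t,1,0)$; the tangent at $P(\infty)$ is the line through $\mathbf P(1,0,0,0)$ and $\mathbf P(0,1,0,0)$. A real chord is a line through two distinct points of $\mathscr C$. For $\alpha\in\mathbb F_{q^2}\setminus\mathbb F_q$, the line of $\mathrm{PG}(3,q^2)$ through $P(\alpha),P(\alpha^q)$ is defined over $\mathbb F_q$, and the corresponding line of $\mathrm{PG}(3,q)$ is an imaginary chord. A unisecant is a line meeting $\mathscr C$ in exactly one point; an external line is a line disjoint from $\mathscr C$. $G_q$ is the group of all projectivities of $\mathrm{PG}(3,q)$ mapping $\mathscr C$ onto itself. For $a,b,c,d\in\mathbb F_q$, $ad-bc\ne0$, let $$M(a,b,c,d)=\begin{pmatrix} a^3&a^2c&ac^2&c^3\\ 3a^2b&a^2d+2abc&bc^2+2acd&3c^2d\\ 3ab^2&b^2c+2abd&ad^2+2bcd&3cd^2\\ b^3&b^2d&bd^2&d^3\end{pmatrix};$$ the projectivities $\mathbf P(x)\mapsto\mathbf P(xM(a,b,c,d))$ form the subgroup $G_q^*\cong PGL(2,q)$ of $G_q$ (critical subgroup). For $q=3$ all four $\Gamma$-planes contain the line $\mathcal A:\ x_0=x_3=0$, called the Ar-line. Line types for $q=3$: RC = real chord; Tr = tangent; IC = imaginary chord; Ar = the line $\mathcal A$; U$\Gamma$ = unisecant which is not a tangent and is contained in some $\Gamma$-plane; Un$\Gamma$ = unisecant contained in no $\Gamma$-plane; EA = external line different from $\mathcal A$ meeting $\mathcal A$;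 En$\Gamma$ = external line not meeting $\mathcal A$ which is not an imaginary chord. Sub-types (these sets are $G_3^*$-orbits): Un$\Gamma_1$ = the $G_3^*$-orbit of the line $\{x_1=-x_2,\ x_1=-x_3\}$ (12 lines); Un$\Gamma_2$ = the $G_3^*$-orbit of the line $\{x_2=0,\ x_1=-x_3\}$ (12 lines); EA$_2$ = the $G_3^*$-orbit of $\{x_0=0,\ x_1=-x_3\}$ (4 lines); EA$_3$ = the $G_3^*$-orbit of $\{x_0=x_2,\ x_3=0\}$ (4 lines); EA$_1$ = the remaining $24$ EA-lines; En$\Gamma_3$ = the $G_3^*$-orbit of $\{x_0=x_2,\ x_1=-x_3\}$ (12 lines); the remaining En$\Gamma$-lines form two $G_3^*$-orbits, En$\Gamma_2$ of size $12$ and En$\Gamma_1$ of size $24$. *)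

theory Defs
  imports Main
begin

text \<open>F_3 is modelled by the integers {0,1,2} with arithmetic mod 3. Vectors of
F_3^4 are integer lists of length 4 with entries in {0,1,2}; a point of PG(3,3)
is the set of nonzero scalar multiples of a nonzero vector; a line is the set of
points of a 2-dimensional subspace; a plane is the set of points satisfying a
linear equation.\<close>

definition F3 :: "int set" where "F3 = {0,1,2}"

type_synonym vec = "int list"

definition vecs :: "vec set" where
  "vecs = {v. length v = 4 \<and> set v \<subseteq> F3}"

definition zerov :: vec where "zerov = [0,0,0,0]"

definition smul :: "int \<Rightarrow> vec \<Rightarrow> vec" where
  "smul c v = map (\<lambda>x. (c * x) mod 3) v"

definition vadd :: "vec \<Rightarrow> vec \<Rightarrow> vec" where
  "vadd u v = map2 (\<lambda>x y. (x + y) mod 3) u v"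

definition pt :: "vec \<Rightarrow> vec set" where
  "pt v = {smul c v | c. c \<in> {1,2}}"

definition Points :: "vec set set" where
  "Points = pt ` (vecs - {zerov})"

definition Line :: "vec \<Rightarrow> vec \<Rightarrow> vec set set" where
  "Line u v = {pt (vadd (smul a u) (smul b v)) | a b. a \<in> F3 \<and> b \<in> F3 \<and> \<not> (a = 0 \<and> b = 0)}"

definition Lines :: "vec set set set" where
  "Lines = {Line u v | u v. u \<in> vecs \<and> v \<in> vecs \<and> u \<noteq> zerov \<and> v \<noteq> zerov \<and> pt u \<noteq> pt v}"

definition dot :: "int list \<Rightarrow> vec \<Rightarrow> int" where
  "dot c x = (\<Sum>i<4. c ! i * x ! i) mod 3"

definition plane :: "int list \<Rightarrow> vec set set" where
  "plane c = {pt x | x. x \<in> vecs \<and> x \<noteq> zerov \<and> dot c x = 0}"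

text \<open>F_3^+ = F_3 \<union> {\<infinity>} is modelled as int option, None = \<infinity>.\<close>
definition Fplus :: "int option set" where
  "Fplus = Some ` F3 \<union> {None}"

definition Pc :: "int option \<Rightarrow> vec set" where
  "Pc t = (case t of None \<Rightarrow> pt [1,0,0,0]
         | Some s \<Rightarrow> pt [s^3 mod 3, s^2 mod 3, s, 1])"

definition Cub :: "vec set set" where
  "Cub = Pc ` Fplus"

definition osc :: "int option \<Rightarrow> vec set set" where
  "osc t = (case t of None \<Rightarrow> plane [0,0,0,1]
          | Some s \<Rightarrow> plane [1, (-3*s) mod 3, (3*s^2) mod 3, (-(s^3)) mod 3])"

definition GammaPlanes :: "vec set set set" where
  "GammaPlanes = osc ` Fplus"

type_synonym mat = "int list list"

definition mats :: "mat set" where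
  "mats = {M. length M = 4 \<and> set M \<subseteq> vecs}"

definition vmat :: "vec \<Rightarrow> mat \<Rightarrow> vec" where
  "vmat x M = map (\<lambda>j. (\<Sum>i<4. x ! i * M ! i ! j) mod 3) [0..<4]"

definition nonsingular :: "mat \<Rightarrow> bool" where
  "nonsingular M \<longleftrightarrow> (\<forall>x\<in>vecs. vmat x M = zerov \<longrightarrow> x = zerov)"

definition proj :: "mat \<Rightarrow> vec set \<Rightarrow> vec set" where
  "proj M p = (\<lambda>x. vmat x M) ` p"

definition G3 :: "mat set" where
  "G3 = {M \<in> mats. nonsingular M \<and> proj M ` Cub = Cub}"

definition Mabcd :: "int \<Rightarrow> int \<Rightarrow> int \<Rightarrow> int \<Rightarrow> mat" where
  "Mabcd a b c d = map (map (\<lambda>x. x mod 3))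
    [[a^3, a^2*c, a*c^2, c^3],
     [3*a^2*b, a^2*d + 2*a*b*c, b*c^2 + 2*a*c*d, 3*c^2*d],
     [3*a*b^2, b^2*c + 2*a*b*d, a*d^2 + 2*b*c*d, 3*c*d^2],
     [b^3, b^2*d, b*d^2, d^3]]"

definition G3star :: "mat set" where
  "G3star = {Mabcd a b c d | a b c d. a \<in> F3 \<and> b \<in> F3 \<and> c \<in> F3 \<and> d \<in> F3 \<and> (a*d - b*c) mod 3 \<noteq> 0}"

definition Gorbit :: "mat set \<Rightarrow> vec set set \<Rightarrow> vec set set set" where
  "Gorbit G L = {proj M ` L | M. M \<in> G}"

definition LineOrbits :: "mat set \<Rightarrow> vec set set set set" where
  "LineOrbits G = {Gorbit G L | L. L \<in> Lines}"

section \<open>F_9 = F_3[i], i^2 = -1, for imaginary chords\<close>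

type_synonym f9 = "int \<times> int"   (* (a,b) means a + b i *)

definition F9 :: "f9 set" where "F9 = F3 \<times> F3"

definition f9add :: "f9 \<Rightarrow> f9 \<Rightarrow> f9" where
  "f9add x y = ((fst x + fst y) mod 3, (snd x + snd y) mod 3)"

definition f9mul :: "f9 \<Rightarrow> f9 \<Rightarrow> f9" where
  "f9mul x y = ((fst x * fst y - snd x * snd y) mod 3, (fst x * snd y + snd x * fst y) mod 3)"

definition f9pow :: "f9 \<Rightarrow> nat \<Rightarrow> f9" where
  "f9pow x n = (f9mul x ^^ n) (1,0)"

text \<open>P(alpha) in PG(3,9), as its normalised coordinate vector\<close>
definition Pc9 :: "f9 \<Rightarrow> f9 list" where
  "Pc9 \<alpha> = [f9pow \<alpha> 3, f9pow \<alpha> 2, \<alpha>, (1,0)]"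

definition inF9span :: "vec \<Rightarrow> vec \<Rightarrow> f9 list \<Rightarrow> bool" where
  "inF9span u v w \<longleftrightarrow> (\<exists>x\<in>F9. \<exists>y\<in>F9. \<forall>j<4.
      f9add (f9mul x (u ! j, 0)) (f9mul y (v ! j, 0)) = w ! j)"

definition RC :: "vec set set \<Rightarrow> bool" where
  "RC L \<longleftrightarrow> L \<in> Lines \<and> (\<exists>p\<in>Cub. \<exists>r\<in>Cub. p \<noteq> r \<and> p \<in> L \<and> r \<in> L)"

definition Tr :: "vec set set \<Rightarrow> bool" where
  "Tr L \<longleftrightarrow> L \<in> Lines \<and>
     ((\<exists>t\<in>F3. Pc (Some t) \<in> L \<and> pt [(3*t^2) mod 3, (2*t) mod 3, 1, 0] \<in> L)
      \<or> (pt [1,0,0,0] \<in> L \<and> pt [0,1,0,0] \<in> L))"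

definition IC :: "vec set set \<Rightarrow> bool" where
  "IC L \<longleftrightarrow> L \<in> Lines \<and>
     (\<exists>u\<in>vecs. \<exists>v\<in>vecs. u \<noteq> zerov \<and> v \<noteq> zerov \<and> pt u \<in> L \<and> pt v \<in> L \<and> pt u \<noteq> pt v \<and>
        (\<exists>\<alpha>\<in>F9. snd \<alpha> \<noteq> 0 \<and> inF9span u v (Pc9 \<alpha>) \<and> inF9span u v (Pc9 (f9pow \<alpha> 3))))"

definition ArLine :: "vec set set" where
  "ArLine = plane [1,0,0,0] \<inter> plane [0,0,0,1]"

definition unisecant :: "vec set set \<Rightarrow> bool" where
  "unisecant L \<longleftrightarrow> L \<in> Lines \<and> card (L \<inter> Cub) = 1"

definition external :: "vec set set \<Rightarrow> bool" where
  "external L \<longleftrightarrow> L \<in> Lines \<and> L \<inter> Cub = {}"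

definition UG :: "vec set set \<Rightarrow> bool" where
  "UG L \<longleftrightarrow> unisecant L \<and> \<not> Tr L \<and> (\<exists>\<pi>\<in>GammaPlanes. L \<subseteq> \<pi>)"

definition UnG :: "vec set set \<Rightarrow> bool" where
  "UnG L \<longleftrightarrow> unisecant L \<and> (\<forall>\<pi>\<in>GammaPlanes. \<not> L \<subseteq> \<pi>)"

definition EA :: "vec set set \<Rightarrow> bool" where
  "EA L \<longleftrightarrow> external L \<and> L \<noteq> ArLine \<and> L \<inter> ArLine \<noteq> {}"

definition EnG :: "vec set set \<Rightarrow> bool" where
  "EnG L \<longleftrightarrow> external L \<and> L \<inter> ArLine = {} \<and> \<not> IC L"

definition UnG1 :: "vec set set set" where
  "UnG1 = Gorbit G3star (plane [0,1,1,0] \<inter> plane [0,1,0,1])"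

definition UnG2 :: "vec set set set" where
  "UnG2 = Gorbit G3star (plane [0,0,1,0] \<inter> plane [0,1,0,1])"

definition EA2 :: "vec set set set" where
  "EA2 = Gorbit G3star (plane [1,0,0,0] \<inter> plane [0,1,0,1])"

definition EA3 :: "vec set set set" where
  "EA3 = Gorbit G3star (plane [1,0,-1,0] \<inter> plane [0,0,0,1])"

definition EA1 :: "vec set set set" where
  "EA1 = {L. EA L} - EA2 - EA3"

definition EnG3 :: "vec set set set" where
  "EnG3 = Gorbit G3star (plane [1,0,-1,0] \<inter> plane [0,1,0,1])"

definition EnG2 :: "vec set set set" where
  "EnG2 = \<Union>{Ob. \<exists>L. EnG L \<and> L \<notin> EnG3 \<and> Ob = Gorbit G3star L \<and> card Ob = 12}"

definition EnG1 :: "vec set set set" where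
  "EnG1 = \<Union>{Ob. \<exists>L. EnG L \<and> L \<notin> EnG3 \<and> Ob = Gorbit G3star L \<and> card Ob = 24}"

end

theory Submission
  imports Defs
begin

text \<open>For q = 3 the twisted cubic has exactly four points, and they form a basis of the space
F_3^4. In coordinates with respect to this basis the group G_3 is the group of all monomial (signed
permutation) matrices, so the line orbits are the monomial equivalence classes of ternary [4,2]
codes. A monomial matrix preserves the Hamming weight of vectors; the set of weights of the points
on a line takes seven values, and the lines sharing such a set are joined to each other by three
transpositions and one sign change. Each line type is then determined on the 130 reduced echelon
forms.\<close>

section \<open>Coordinates over the field with three elements\<close>

text \<open>\<open>G3\<close> is cut out of 3^16 matrices, too many to enumerate by rewriting. Its
  orbits are therefore bounded from two sides: all of \<open>G3\<close> preserves weight sets, and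
  four explicit members already connect the lines with equal weight set. Only \<open>G3star\<close>
  is enumerated, through the 48 quadruples of nonzero determinant. The gap between the two groups is
  a matter of signs. PGL(2,3) acts faithfully on the four points of the cubic, as the full symmetric
  group; a sign change of one basis vector also fixes all four points without being the identity.
  Such sign changes are what merges, for instance, the tangents with \<open>UnG2\<close>. Every
  finite check is done by \<open>code_simp\<close>, so F_3 and F_3^4 are rebuilt as datatypes whose
  arithmetic and equality reduce on constructors, and lines are compared through echelon forms
  instead of as sets of sets of lists. \<open>ln4\<close> and \<open>rclass\<close> carry the
  results back to the given model.\<close>

datatype f3 = F0 | F1 | F2

instantiation f3 :: comm_ring_1
begin

definition "0 = F0"
definition "1 = F1"

fun uminus_f3 where
  "- F0 = F0"
| "- F1 = F2"
| "- F2 = F1"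

fun plus_f3 where
  "F0 + y = (y :: f3)"
| "F1 + F0 = F1"
| "F1 + F1 = F2"
| "F1 + F2 = F0"
| "F2 + F0 = F2"
| "F2 + F1 = F0"
| "F2 + F2 = F1"

fun times_f3 where
  "F0 * y = F0"
| "F1 * y = (y :: f3)"
| "F2 * y = - (y :: f3)"

definition "a - b = a + (- b :: f3)"

instance
proof
  fix a b c :: f3
  show "a * b * c = a * (b * c)" "a * b = b * a" "1 * a = a" "a + b + c = a + (b + c)"
    "a + b = b + a" "0 + a = a" "- a + a = 0" "a - b = a + - b" "(a + b) * c = a * c + b * c"
    "(0 :: f3) \<noteq> 1"
    by (cases a; cases b; cases c; simp add: zero_f3_def one_f3_def minus_f3_def)+
qed

end

datatype vec4 = V f3 f3 f3 f3

instantiation vec4 :: ab_group_add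
begin

definition "0 = V F0 F0 F0 F0"

fun uminus_vec4 where
  "- V a b c d = V (- a) (- b) (- c) (- d)"

fun plus_vec4 where
  "V a b c d + V a' b' c' d' = V (a + a') (b + b') (c + c') (d + d')"

definition "x - y = x + (- y :: vec4)"

instance
proof
  fix a b c :: vec4
  show "a + b + c = a + (b + c)" "a + b = b + a" "0 + a = a" "- a + a = 0" "a - b = a + - b"
    by (cases a; cases b; cases c; simp add: zero_vec4_def minus_vec4_def
        flip: zero_f3_def)+
qed

end

fun scale :: "f3 \<Rightarrow> vec4 \<Rightarrow> vec4" where
  "scale k (V a b c d) = V (k * a) (k * b) (k * c) (k * d)"

lemma scale_simps [simp]: "scale F0 x = 0" "scale F1 x = x" "scale F2 x = - x"
  by (cases x; simp add: zero_vec4_def)+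

definition f3s :: "f3 list" where
  "f3s = [F0, F1, F2]"

definition vec4s :: "vec4 list" where
  "vec4s = [V a b c d. a \<leftarrow> f3s, b \<leftarrow> f3s, c \<leftarrow> f3s, d \<leftarrow> f3s]"

lemma set_f3s [simp]: "set f3s = UNIV"
  unfolding f3s_def using f3.exhaust by auto

lemma set_vec4s [simp]: "set vec4s = UNIV"
proof -
  have "x \<in> set vec4s" for x
    by (cases x) (simp add: vec4s_def, blast)
  then show ?thesis by blast
qed

section \<open>Lines in reduced echelon form\<close>

fun lead_coeff4 :: "vec4 \<Rightarrow> f3" where
  "lead_coeff4 (V a b c d) =
    (if a \<noteq> F0 then a else if b \<noteq> F0 then b else if c \<noteq> F0 then c else d)"

fun lead_pos :: "vec4 \<Rightarrow> nat" where
  "lead_pos (V a b c d) = (if a \<noteq> F0 then 0 else if b \<noteq> F0 then 1 else if c \<noteq> F0 then 2 else 3)"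

text \<open>Nonzero elements of F_3 are their own inverses, so products replace quotients.\<close>

fun lead_quot :: "vec4 \<Rightarrow> vec4 \<Rightarrow> f3" where
  "lead_quot (V a b c d) (V a' b' c' d') =
    (if a \<noteq> F0 then a * a' else if b \<noteq> F0 then b * b' else if c \<noteq> F0 then c * c' else d * d')"

definition normalise :: "vec4 \<Rightarrow> vec4" where
  "normalise x = scale (lead_coeff4 x) x"

definition reduce :: "vec4 \<Rightarrow> vec4 \<Rightarrow> vec4" where
  "reduce u v = v - scale (lead_quot u v) u"

text \<open>Second elimination step: by then \<open>v\<close> vanishes in the pivot column of
  \<open>u\<close>, so clearing the pivot column of \<open>v\<close> in \<open>u\<close> keeps the
  leading 1 of \<open>u\<close>, and no further normalisation is needed.\<close>

fun canon1 where
  "canon1 u v = (reduce v u, v)"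

fun canon2 where
  "canon2 (u, v) = (if lead_pos u < lead_pos v then (u, v) else (v, u))"

fun canon :: "vec4 \<times> vec4 \<Rightarrow> vec4 \<times> vec4" where
  "canon (u, v) = canon2 (canon1 (normalise u) (normalise (reduce u v)))"

fun is_rref :: "vec4 \<times> vec4 \<Rightarrow> bool" where
  "is_rref (u, v) \<longleftrightarrow> lead_pos u < lead_pos v \<and> lead_coeff4 u = F1 \<and> lead_coeff4 v = F1
    \<and> lead_quot v u = F0"

definition indep :: "vec4 \<Rightarrow> vec4 \<Rightarrow> bool" where
  "indep u v \<longleftrightarrow> u \<noteq> 0 \<and> v \<noteq> 0 \<and> u \<noteq> v \<and> u \<noteq> - v"

text \<open>The 40 points of PG(3,3) by normalised vectors; zero drops out because its
  \<open>lead_coeff4\<close> is \<open>F0\<close>.\<close>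

definition points4 :: "vec4 list" where
  "points4 = filter (\<lambda>x. lead_coeff4 x = F1) vec4s"

lemma set_points4: "set points4 = {x. lead_coeff4 x = F1}"
  by (simp add: points4_def)

text \<open>One block for each choice of two pivot columns: 81 + 27 + 9 + 9 + 3 + 1 = 130.\<close>

definition rrefs :: "(vec4 \<times> vec4) list" where
  "rrefs =
    [(V F1 F0 a b, V F0 F1 c d). a \<leftarrow> f3s, b \<leftarrow> f3s, c \<leftarrow> f3s, d \<leftarrow> f3s] @
    [(V F1 a F0 b, V F0 F0 F1 c). a \<leftarrow> f3s, b \<leftarrow> f3s, c \<leftarrow> f3s] @
    [(V F1 a b F0, V F0 F0 F0 F1). a \<leftarrow> f3s, b \<leftarrow> f3s] @
    [(V F0 F1 F0 a, V F0 F0 F1 b). a \<leftarrow> f3s, b \<leftarrow> f3s] @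
    [(V F0 F1 a F0, V F0 F0 F0 F1). a \<leftarrow> f3s] @
    [(V F0 F0 F1 F0, V F0 F0 F0 F1)]"

lemma is_rref_imp_rrefs: "is_rref r \<Longrightarrow> r \<in> set rrefs"
proof (cases r)
  fix u v assume *: "is_rref r" "r = (u, v)"
  show ?thesis
    using * by (cases u; cases v) (simp add: rrefs_def image_iff split: if_splits; blast)
qed

text \<open>Normalised vectors suffice because \<open>Lines_eq\<close> normalises a spanning pair
  before it applies \<open>canon\<close>; this leaves 40 * 39 pairs to evaluate.\<close>

lemma canon_points4:
  "\<forall>u\<in>set points4. \<forall>v\<in>set points4. u \<noteq> v \<longrightarrow> is_rref (canon (u, v))"
  by code_simp

lemma distinct_rrefs: "distinct rrefs"
  by code_simp

fun pts :: "vec4 \<times> vec4 \<Rightarrow> vec4 list" where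
  "pts (u, v) = [u, v, u + v, u - v]"

text \<open>The leading 1 of \<open>u\<close> comes before the pivot of \<open>v\<close> and
  survives in \<open>u + v\<close> and \<open>u - v\<close>, so the listed points are already
  normalised. The second clause is uniqueness of the echelon form and gives
  \<open>inj_on_ln4\<close>.\<close>

lemma pts_rrefs:
  "\<forall>r\<in>set rrefs. \<forall>p\<in>set (pts r). lead_coeff4 p = F1 \<and>
     (\<forall>q\<in>set (pts r). is_rref (p, q) \<longrightarrow> (p, q) = r)"
  by code_simp

lemma is_rref_rrefs: "\<forall>r\<in>set rrefs. is_rref r"
  by code_simp

section \<open>Weight sets and their connectedness\<close>

fun wt :: "vec4 \<Rightarrow> nat" where
  "wt (V a b c d) = length (filter (\<lambda>x. x \<noteq> F0) [a, b, c, d])"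

definition wts :: "vec4 \<times> vec4 \<Rightarrow> nat set" where
  "wts r = set (map wt (pts r))"

text \<open>Listed in the order of the orbits \<open>L1\<close> to \<open>L7\<close>;
  \<open>reps\<close> follows the same order.\<close>

definition profiles :: "nat set list" where
  "profiles = [{1,2},{2,4},{1,3,4},{3},{1,2,3},{2,3,4},{2,3}]"

fun comb :: "vec4 \<times> vec4 \<times> vec4 \<times> vec4 \<Rightarrow> vec4 \<Rightarrow> vec4" where
  "comb (p, q, r, s) (V a b c d) = scale a p + scale b q + scale c r + scale d s"

abbreviation "e1 \<equiv> V F1 F0 F0 F0"
abbreviation "e2 \<equiv> V F0 F1 F0 F0"
abbreviation "e3 \<equiv> V F0 F0 F1 F0"
abbreviation "e4 \<equiv> V F0 F0 F0 F1"

text \<open>All four are involutions, so inverses come for free in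
  \<open>linked_gens\<close>.\<close>

definition gens where
  "gens = [(- e1, e2, e3, e4), (e2, e1, e3, e4), (e1, e3, e2, e4), (e1, e2, e4, e3)]"

fun image_pair where
  "image_pair w (u, v) = canon (comb w u, comb w v)"

text \<open>Breadth-first search under the generators. The helper functions match on pairs because
code_simp would otherwise unfold recursive calls and definitions under binders, before their
arguments are known.\<close>

definition new_images where
  "new_images seen front =
     filter (\<lambda>r. r \<notin> set seen) (remdups [image_pair w r. r \<leftarrow> front, w \<leftarrow> gens])"

fun grow_join where
  "grow_join seen new = (new @ seen, new)"
fun grow1 where
  "grow1 (seen, front) = grow_join seen (new_images seen front)"

primrec grow where
  "grow 0 p = fst p"
| "grow (Suc n) p = grow n (grow1 p)"

definition reps :: "(vec4 \<times> vec4) list" where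
  "reps = [(e1, e2), (V F1 F0 F0 F1, V F0 F1 F1 F0), (e1, V F0 F1 F1 F1),
    (V F1 F0 F1 F1, V F0 F1 F1 F2), (e1, V F0 F1 F0 F1),
    (V F1 F0 F0 F1, V F0 F1 F1 F1), (V F1 F0 F0 F1, V F0 F1 F0 F1)]"

lemma wts_reps: "map wts reps = profiles"
  by code_simp

lemma reps_rrefs: "\<forall>r\<in>set reps. is_rref r"
  by code_simp

lemma distinct_profiles: "distinct profiles"
  by code_simp

lemma wts_in_profiles: "\<forall>r\<in>set rrefs. wts r \<in> set profiles"
  by code_simp

text \<open>The 9 is a search depth that \<open>covered_reps\<close> confirms to be enough for each
  representative.\<close>

fun covered where
  "covered (u, v) \<longleftrightarrow>
     set (filter (\<lambda>r. wts r = wts (u, v)) rrefs) \<subseteq> set (grow 9 ([(u, v)], [(u, v)]))"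

lemma covered_reps: "\<forall>r\<in>set reps. covered r"
  by code_simp

lemma card_profiles:
  "map (\<lambda>P. length (filter (\<lambda>r. wts r = P) rrefs)) profiles = [6, 12, 16, 8, 24, 48, 16]"
  by code_simp

section \<open>Line types in coordinates\<close>

definition units :: "vec4 list" where
  "units = [e1, e2, e3, e4]"

fun ncub where
  "ncub (u, v) = length (filter (\<lambda>e. e \<in> set (pts (u, v))) units)"

text \<open>Each point P(t) with a second point of its tangent, for t = 0, 1, 2, \<open>\<infinity>\<close>.\<close>

definition tangents :: "(vec4 \<times> vec4) list" where
  "tangents = [(e2, V F1 F0 F1 F2), (e3, V F1 F2 F0 F1), (e4, V F1 F1 F2 F0), (e1, V F0 F1 F1 F1)]"

text \<open>The coordinates of the real and imaginary part of P(\<open>\<alpha>\<close>), for \<open>\<alpha>\<close> = i, 1 + i, 2 + i.\<close>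

definition imag_chords :: "(vec4 \<times> vec4) list" where
  "imag_chords = [(V F0 F1 F2 F2, V F1 F0 F2 F1), (V F0 F1 F2 F1, V F1 F1 F0 F2),
            (V F0 F1 F1 F2, V F1 F2 F1 F0)]"

definition on_both where
  "on_both r pq \<longleftrightarrow> fst pq \<in> set (pts r) \<and> snd pq \<in> set (pts r)"

fun tangent_rref where
  "tangent_rref (u, v) \<longleftrightarrow> list_ex (on_both (u, v)) tangents"

fun imag_rref where
  "imag_rref (u, v) \<longleftrightarrow> list_ex (on_both (u, v)) imag_chords"

text \<open>The linear form with coefficients k0, ..., k3 in the standard coordinates, evaluated in the
coordinates of the cubic basis.\<close>

fun form :: "f3 \<times> f3 \<times> f3 \<times> f3 \<Rightarrow> vec4 \<Rightarrow> f3" where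
  "form (k0, k1, k2, k3) (V a b c d) =
     k0 * (a + c - d) + k1 * (c + d) + k2 * (c - d) + k3 * (b + c + d)"

text \<open>In characteristic 3 the osculating plane at \<open>t\<close> is
  \<open>x0 - t^3 x3 = 0\<close>; the order is infinity, 0, 1, 2.\<close>

definition gamma_forms :: "(f3 \<times> f3 \<times> f3 \<times> f3) list" where
  "gamma_forms = [(F0,F0,F0,F1), (F1,F0,F0,F0), (F1,F0,F0,F2), (F1,F0,F0,F1)]"

definition meet where
  "meet k k' = filter (\<lambda>p. form k p = F0 \<and> form k' p = F0) points4"

definition ug_rref where
  "ug_rref r \<longleftrightarrow> ncub r = 1 \<and> \<not> tangent_rref r \<and>
     list_ex (\<lambda>k. list_all (\<lambda>p. form k p = F0) (pts r)) gamma_forms"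

text \<open>Its four points are exactly the second points in \<open>tangents\<close>: in
  characteristic 3 every tangent meets the Ar-line.\<close>

definition ar_rref where "ar_rref = (V F1 F0 F1 F2, V F0 F1 F1 F1)"

definition ea_rref where
  "ea_rref r \<longleftrightarrow> ncub r = 0 \<and> r \<noteq> ar_rref \<and> list_ex (\<lambda>p. p \<in> set (pts ar_rref)) (pts r)"

definition eng_rref where
  "eng_rref r \<longleftrightarrow> ncub r = 0 \<and> list_all (\<lambda>p. p \<notin> set (pts ar_rref)) (pts r) \<and> \<not> imag_rref r"

text \<open>The vector (s^3, s^2 t, s t^2, t^3). The matrix M(a,b,c,d) maps it to the corresponding
vector of (a s + b t, c s + d t), which gives the images of the four basis vectors.\<close>

fun cubv :: "f3 \<Rightarrow> f3 \<Rightarrow> vec4" where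
  "cubv F0 F0 = 0"
| "cubv F1 F0 = e1"
| "cubv F2 F0 = - e1"
| "cubv F0 F1 = e2"
| "cubv F0 F2 = - e2"
| "cubv F1 F1 = e3"
| "cubv F2 F2 = - e3"
| "cubv F2 F1 = e4"
| "cubv F1 F2 = - e4"

definition star_quad where
  "star_quad a b c d = (cubv a c, cubv b d, cubv (a + b) (c + d), cubv (b - a) (d - c))"

definition star where
  "star = [star_quad a b c d.
     a \<leftarrow> f3s, b \<leftarrow> f3s, c \<leftarrow> f3s, d \<leftarrow> f3s, a * d - b * c \<noteq> F0]"

definition star_orbit where
  "star_orbit r = map (\<lambda>w. image_pair w r) star"

text \<open>These facts let \<open>wclass_eqs\<close> recognise unions of types as full weight
  classes. Tangents, imaginary chords and UG-lines each stay inside one class, EA- and EnG-lines are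
  split by the weights, and the later items say which types exhaust a class. Real chords are special
  because weight 1 singles out the points of the cubic.\<close>

lemma rref_profiles:
  "\<forall>r\<in>set rrefs. 2 \<le> ncub r \<longleftrightarrow> wts r = {1,2}"
  "\<forall>r\<in>set rrefs. tangent_rref r \<longrightarrow> wts r = {1,3,4}"
  "\<forall>r\<in>set rrefs. imag_rref r \<longrightarrow> wts r = {3}"
  "\<forall>r\<in>set rrefs. ug_rref r \<longrightarrow> wts r = {1,2,3}"
  "\<forall>r\<in>set rrefs. ea_rref r \<longrightarrow> wts r \<in> {{3},{2,3},{2,3,4}}"
  "\<forall>r\<in>set rrefs. eng_rref r \<longrightarrow> wts r \<in> {{2,4},{2,3},{2,3,4}}"
  "\<forall>r\<in>set rrefs. wts r = {2,4} \<longrightarrow> eng_rref r"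
  "\<forall>r\<in>set rrefs. wts r = {3} \<longrightarrow> imag_rref r \<or> ea_rref r \<or> r = ar_rref"
  "\<forall>r\<in>set rrefs. wts r \<in> {{2,3,4},{2,3}} \<longrightarrow> ea_rref r \<or> eng_rref r"
  "wts ar_rref = {3}"
  by code_simp+

definition un1_rref where "un1_rref = (e1, V F0 F1 F0 F1)"
definition un2_rref where "un2_rref = (e1, V F0 F1 F2 F2)"
definition ea2_rref where "ea2_rref = (V F1 F0 F1 F2, V F0 F1 F2 F2)"
definition ea3_rref where "ea3_rref = (V F0 F1 F0 F2, V F0 F0 F1 F2)"
definition en3_rref where "en3_rref = (V F0 F1 F0 F1, V F0 F0 F1 F2)"

lemma set_meet:
  "set (meet (F0,F1,F1,F0) (F0,F1,F0,F1)) = set (pts un1_rref)"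
  "set (meet (F0,F0,F1,F0) (F0,F1,F0,F1)) = set (pts un2_rref)"
  "set (meet (F1,F0,F0,F0) (F0,F1,F0,F1)) = set (pts ea2_rref)"
  "set (meet (F1,F0,F2,F0) (F0,F0,F0,F1)) = set (pts ea3_rref)"
  "set (meet (F1,F0,F2,F0) (F0,F1,F0,F1)) = set (pts en3_rref)"
  "set (meet (F1,F0,F0,F0) (F0,F0,F0,F1)) = set (pts ar_rref)"
  by code_simp+

text \<open>Types that are given only as the orbit of one line become predicates on echelon forms,
  so that they can be counted and compared with the other types.\<close>

lemma set_star_orbit:
  "set (star_orbit un1_rref) = set (filter (\<lambda>r. wts r = {1,2,3} \<and> \<not> ug_rref r) rrefs)"
  "set (star_orbit un2_rref) = set (filter (\<lambda>r. wts r = {1,3,4} \<and> \<not> tangent_rref r) rrefs)"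
  "set (star_orbit ea2_rref) = set (filter (\<lambda>r. wts r = {3} \<and> ea_rref r) rrefs)"
  "set (star_orbit ea3_rref) = set (filter (\<lambda>r. wts r = {2,3} \<and> ea_rref r) rrefs)"
  "set (star_orbit en3_rref) = set (filter (\<lambda>r. wts r = {2,3} \<and> eng_rref r) rrefs)"
  by code_simp+

text \<open>\<open>EnG1\<close> and \<open>EnG2\<close> are defined by orbit sizes, so the orbit of
  every remaining line is examined, not that of one representative. It is passed as an argument to
  be shared by the three tests.\<close>

fun same_class where
  "same_class (u, v) orb \<longleftrightarrow>
     length orb = (if wts (u, v) = {2,4} then 12 else 24) \<and> (u, v) \<in> set orb \<and>
     list_all (\<lambda>s. is_rref s \<and> eng_rref s \<and> wts s = wts (u, v)) orb"

fun eng_orbit where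
  "eng_orbit (u, v) \<longleftrightarrow> same_class (u, v) (remdups (star_orbit (u, v)))"

lemma eng_orbit_all: "\<forall>r\<in>set (filter (\<lambda>r. eng_rref r \<and> wts r \<noteq> {2,3}) rrefs). eng_orbit r"
  by code_simp

lemma card_subclasses:
  "map (\<lambda>P. length (filter P rrefs)) [tangent_rref, imag_rref, ug_rref] = [4, 3, 12]"
  "map (\<lambda>A. length (filter (\<lambda>r. wts r = A \<and> ea_rref r) rrefs)) [{3},{2,3},{2,3,4}] = [4, 4, 24]"
  "map (\<lambda>A. length (filter (\<lambda>r. wts r = A \<and> eng_rref r) rrefs)) [{2,4},{2,3},{2,3,4}] = [12, 12, 24]"
  "length (filter (\<lambda>r. wts r = {1,3,4} \<and> \<not> tangent_rref r) rrefs) = 12"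
  "length (filter (\<lambda>r. wts r = {1,2,3} \<and> \<not> ug_rref r) rrefs) = 12"
  by code_simp+

section \<open>Embedding into the model of PG(3,3)\<close>

fun f3_int :: "f3 \<Rightarrow> int" where
  "f3_int F0 = 0"
| "f3_int F1 = 1"
| "f3_int F2 = 2"

declare zero_f3_def [simp]

lemma f3_add_F0 [simp]: "a + F0 = a"
  by (cases a; simp)

lemma f3_diff_F0 [simp]: "a - F0 = a"
  by (simp add: minus_f3_def)

lemma f3_diff_simps [simp]: "F0 - F1 = F2" "F0 - F2 = F1" "F1 - F2 = F2" "F2 - F1 = F1"
  by (simp_all add: minus_f3_def)

lemma f3_double [simp]: "a + a = - (a :: f3)"
  by (cases a; simp)

lemma f3_cases: "a = F0 \<or> a = F1 \<or> a = F2"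
  by (cases a) auto

lemma f3_int_add: "f3_int (a + b) = (f3_int a + f3_int b) mod 3"
  by (cases a; cases b; simp)

lemma f3_int_mult: "f3_int (a * b) = (f3_int a * f3_int b) mod 3"
  by (cases a; cases b; simp)

lemma f3_int_diff: "f3_int (a - b) = (f3_int a - f3_int b) mod 3"
  by (cases a; cases b; simp add: minus_f3_def)

lemma f3_int_eq_0_iff [simp]: "f3_int a = 0 \<longleftrightarrow> a = F0"
  by (cases a; simp)

lemma f3_int_eq_iff [simp]: "f3_int a = f3_int b \<longleftrightarrow> a = b"
  by (cases a; cases b; simp)

lemma f3_int_range: "F3 = range f3_int"
proof -
  have "UNIV = {F0, F1, F2}" using f3.exhaust by auto
  then have "range f3_int = f3_int ` {F0, F1, F2}" by simp
  then show ?thesis by (simp add: F3_def)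
qed

text \<open>V a b c d stands for a P(\<open>\<infinity>\<close>) + b P(0) + c P(1) + d P(2).\<close>

fun emb :: "vec4 \<Rightarrow> vec" where
  "emb (V a b c d) = [f3_int (a + c - d), f3_int (c + d), f3_int (c - d), f3_int (b + c + d)]"

lemma vadd_emb: "vadd (emb x) (emb y) = emb (x + y)"
  by (cases x; cases y) (simp add: vadd_def algebra_simps flip: f3_int_add)

lemma smul_emb: "smul (f3_int k) (emb x) = emb (scale k x)"
  by (cases x) (simp add: smul_def algebra_simps flip: f3_int_mult)

lemma smul_1_emb [simp]: "smul 1 (emb x) = emb x"
  using smul_emb[of F1] by simp

lemma smul_2_emb [simp]: "smul 2 (emb x) = emb (- x)"
  using smul_emb[of F2] by simp

lemma emb_0 [simp]: "emb 0 = zerov"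
  by (simp add: zero_vec4_def zerov_def minus_f3_def)

lemma inj_emb: "inj emb"
proof (rule injI)
  fix x y assume *: "emb x = emb y"
  obtain a b c d a' b' c' d' where xy: "x = V a b c d" "y = V a' b' c' d'"
    by (metis vec4.exhaust)
  have cd: "c + d = c' + d'" "c - d = c' - d'"
    using * by (auto simp: xy)
  have "c = c' \<and> d = d'"
    using cd by (cases c; cases d; cases c'; cases d'; simp add: minus_f3_def)
  then show "x = y"
    using * by (simp add: xy)
qed

lemma emb_eq_iff [simp]: "emb x = emb y \<longleftrightarrow> x = y"
  using inj_emb by (auto dest: injD)

lemma emb_eq_zerov_iff [simp]: "emb x = zerov \<longleftrightarrow> x = 0"
  using emb_eq_iff[of x 0] by simp

lemma vecs_eq: "vecs = range emb"
proof
  show "range emb \<subseteq> vecs"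
  proof
    fix v assume "v \<in> range emb"
    then obtain x where "v = emb x" by blast
    then show "v \<in> vecs"
      by (cases x) (auto simp: vecs_def f3_int_range)
  qed
  show "vecs \<subseteq> range emb"
  proof
    fix v assume "v \<in> vecs"
    then have "length v = 4" "set v \<subseteq> range f3_int"
      by (auto simp: vecs_def f3_int_range)
    then obtain p q r s where "v = [f3_int p, f3_int q, f3_int r, f3_int s]"
      by (auto simp: length_Suc_conv numeral_eq_Suc)
    \<comment> \<open>The equations \<open>c + d = q\<close> and \<open>c - d = r\<close> are solved
      with 1/2 = -1 in F_3; the outer coordinates then give \<open>a\<close> and
      \<open>b\<close>.\<close>
    also have "\<dots> = emb (V (p - r) (s - q) (- (q + r)) (r - q))"
      by (cases q; cases r) (simp_all add: minus_f3_def add.assoc)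
    finally show "v \<in> range emb" by blast
  qed
qed

section \<open>Points and lines in the cubic basis\<close>

definition pnt :: "vec4 \<Rightarrow> vec set" where
  "pnt x = pt (emb x)"

lemma pnt_eq: "pnt x = {emb x, emb (- x)}"
proof -
  have "pnt x = {smul 1 (emb x), smul 2 (emb x)}"
    unfolding pnt_def pt_def by blast
  then show ?thesis by simp
qed

lemma pnt_eq_iff: "pnt x = pnt y \<longleftrightarrow> x = y \<or> x = - y"
  by (auto simp: pnt_eq doubleton_eq_iff)

lemma pnt_uminus [simp]: "pnt (- x) = pnt x"
  by (simp add: pnt_eq_iff)

fun ln4 :: "vec4 \<times> vec4 \<Rightarrow> vec set set" where
  "ln4 (u, v) = {pnt u, pnt v, pnt (u + v), pnt (u - v)}"

lemma ln4_pts: "ln4 r = pnt ` set (pts r)"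
  by (cases r) simp

lemma Line_emb: "Line (emb u) (emb v) = ln4 (u, v)"
proof -
  define g where "g a b = pnt (scale a u + scale b v)" for a b
  have eq: "pt (vadd (smul (f3_int a) (emb u)) (smul (f3_int b) (emb v))) = g a b" for a b
    by (simp add: smul_emb vadd_emb pnt_def g_def)
  have "Line (emb u) (emb v) = {g a b | a b. \<not> (a = F0 \<and> b = F0)}"
    unfolding Line_def f3_int_range eq[symmetric] by force
  also have "\<dots> = (\<lambda>(a, b). g a b) ` (UNIV - {(F0, F0)})"
    by force
  also have "UNIV - {(F0, F0)} = {(F0, F1), (F0, F2), (F1, F0), (F1, F1), (F1, F2), (F2, F0), (F2, F1), (F2, F2)}"
  proof -
    have "(a, b) \<noteq> (F0, F0) \<longleftrightarrow> (a, b) \<in> {(F0, F1), (F0, F2), (F1, F0), (F1, F1), (F1, F2), (F2, F0), (F2, F1), (F2, F2)}" for a b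
      by (cases a; cases b; simp)
    then show ?thesis by (simp add: set_eq_iff)
  qed
  also have "(\<lambda>(a, b). g a b) ` \<dots> = ln4 (u, v)"
  proof -
    have "g F0 F1 = pnt v" "g F0 F2 = pnt v" "g F1 F0 = pnt u" "g F1 F1 = pnt (u + v)"
      "g F1 F2 = pnt (u - v)" "g F2 F0 = pnt u" "g F2 F1 = pnt (u - v)" "g F2 F2 = pnt (u + v)"
      by (simp_all add: g_def pnt_eq_iff)
    then show ?thesis by auto
  qed
  finally show ?thesis .
qed

lemma normalise_cases: "normalise x = x \<or> normalise x = - x"
  using f3_cases[of "lead_coeff4 x"]
  by (cases x) (auto simp: normalise_def zero_vec4_def split: if_splits)

lemma pnt_normalise [simp]: "pnt (normalise x) = pnt x"
  using normalise_cases[of x] by (auto simp: pnt_eq_iff)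

lemma ln4_swap: "ln4 (u, v) = ln4 (v, u)"
proof -
  have "pnt (u - v) = pnt (v - u)" by (simp add: pnt_eq_iff)
  then show ?thesis by (auto simp: add.commute)
qed

lemma ln4_uminus: "ln4 (u, - v) = ln4 (u, v)"
  by auto

lemma vec4_double [simp]: "x + x = - (x :: vec4)"
  by (cases x) simp

text \<open>Since \<open>u + u = - u\<close>, the replacement permutes the three points other than
  \<open>u\<close> cyclically.\<close>

lemma ln4_add: "ln4 (u, v + u) = ln4 (u, v)"
proof -
  have "u + (v + u) = v - u"
  proof -
    have "u + (v + u) = v + (u + u)" by (simp only: add_ac)
    then show ?thesis by simp
  qed
  then have "pnt (u + (v + u)) = pnt (u - v)" by (simp add: pnt_eq_iff)
  moreover have "pnt (u - (v + u)) = pnt v" by (simp add: pnt_eq_iff)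
  moreover have "pnt (v + u) = pnt (u + v)" by (simp only: add.commute)
  ultimately show ?thesis by (simp only: ln4.simps) blast
qed

lemma ln4_diff: "ln4 (u, v - u) = ln4 (u, v)"
  using ln4_add[of u "v - u"] by simp

lemma ln4_reduce: "ln4 (u, reduce u v) = ln4 (u, v)"
  using f3_cases[of "lead_quot u v"]
  by (auto simp: reduce_def ln4_add ln4_diff simp del: ln4.simps)

lemma ln4_normalise: "ln4 (u, normalise v) = ln4 (u, v)"
  using normalise_cases[of v] by (auto simp: ln4_uminus simp del: ln4.simps)

lemma ln4_canon: "ln4 (canon (u, v)) = ln4 (u, v)"
proof -
  have c2: "ln4 (canon2 r) = ln4 r" for r
    by (cases r) (simp add: ln4_swap del: ln4.simps)
  show ?thesis
    unfolding canon.simps canon1.simps c2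
    by (metis ln4_swap ln4_reduce ln4_normalise)
qed

lemma lead_coeff4_normalise_all: "\<forall>x\<in>set vec4s. x \<noteq> 0 \<longrightarrow> lead_coeff4 (normalise x) = F1"
  by code_simp

lemma lead_coeff4_normalise: "x \<noteq> 0 \<Longrightarrow> lead_coeff4 (normalise x) = F1"
  using lead_coeff4_normalise_all by simp

lemma normalise_eq_0_iff [simp]: "normalise x = 0 \<longleftrightarrow> x = 0"
  using normalise_cases[of x] by auto

lemma Lines_eq_indep: "Lines = {ln4 (u, v) | u v. indep u v}"
proof -
  have "Lines = {Line (emb u) (emb v) | u v. u \<noteq> 0 \<and> v \<noteq> 0 \<and> pnt u \<noteq> pnt v}"
    unfolding Lines_def vecs_eq pnt_def by force
  then show ?thesis
    by (simp add: Line_emb pnt_eq_iff indep_def del: ln4.simps)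
qed

lemma lead_pos_uminus [simp]: "lead_pos (- x) = lead_pos x"
proof (cases x)
  case (V a b c d)
  have "- p = F0 \<longleftrightarrow> p = F0" for p by (cases p; simp)
  then show ?thesis by (simp add: V)
qed

lemma indep_rrefs:
  assumes "(u, v) \<in> set rrefs"
  shows "indep u v"
proof -
  have "is_rref (u, v)" using assms is_rref_rrefs by blast
  then have "lead_pos u \<noteq> lead_pos v" "u \<noteq> 0" "v \<noteq> 0"
    by (auto simp: zero_vec4_def)
  then show ?thesis by (auto simp: indep_def)
qed

lemma Lines_eq: "Lines = ln4 ` set rrefs"
proof
  show "Lines \<subseteq> ln4 ` set rrefs"
  proof
    fix L assume "L \<in> Lines"
    then obtain u v where uv: "L = ln4 (u, v)" "indep u v"
      unfolding Lines_eq_indep by blast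
    let ?u = "normalise u" and ?v = "normalise v"
    have "?u \<in> set points4" "?v \<in> set points4"
      using uv(2) by (auto simp: set_points4 lead_coeff4_normalise indep_def)
    moreover have "pnt ?u \<noteq> pnt ?v"
      using uv(2) by (auto simp: indep_def pnt_eq_iff)
    ultimately have "is_rref (canon (?u, ?v))"
      using canon_points4 by metis
    moreover have "L = ln4 (canon (?u, ?v))"
      unfolding uv ln4_canon by (metis ln4_normalise ln4_swap)
    ultimately show "L \<in> ln4 ` set rrefs"
      using is_rref_imp_rrefs by blast
  qed
  show "ln4 ` set rrefs \<subseteq> Lines"
  proof
    fix L assume "L \<in> ln4 ` set rrefs"
    then obtain u v where uv: "L = ln4 (u, v)" "(u, v) \<in> set rrefs" by force
    then have "indep u v" by (simp add: indep_rrefs)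
    then show "L \<in> Lines"
      using uv unfolding Lines_eq_indep by blast
  qed
qed

lemma inj_on_pnt: "inj_on pnt (set points4)"
proof (rule inj_onI)
  fix x y assume "x \<in> set points4" "y \<in> set points4" "pnt x = pnt y"
  moreover have "lead_coeff4 (- x) = - lead_coeff4 x" for x
  proof (cases x)
    case (V a b c d)
    have "- p = F0 \<longleftrightarrow> p = F0" for p by (cases p; simp)
    then show ?thesis by (simp add: V)
  qed
  ultimately show "x = y"
    by (auto simp: set_points4 pnt_eq_iff)
qed

lemma pts_points4: "r \<in> set rrefs \<Longrightarrow> set (pts r) \<subseteq> set points4"
  using pts_rrefs by (auto simp: set_points4)

lemma pnt_in_ln4: "r \<in> set rrefs \<Longrightarrow> p \<in> set points4 \<Longrightarrow> pnt p \<in> ln4 r \<longleftrightarrow> p \<in> set (pts r)"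
  unfolding ln4_pts using pts_points4 inj_on_pnt by (meson inj_on_image_mem_iff)

lemma inj_on_ln4: "inj_on ln4 (set rrefs)"
proof (rule inj_onI)
  fix r s assume *: "r \<in> set rrefs" "s \<in> set rrefs" "ln4 r = ln4 s"
  obtain u v where s: "s = (u, v)" by force
  have "set (pts r) = set (pts s)"
    using *  pts_points4 inj_on_pnt unfolding ln4_pts by (metis inj_on_image_eq_iff)
  then have "u \<in> set (pts r)" "v \<in> set (pts r)" by (auto simp: s)
  moreover have "is_rref (u, v)" using * is_rref_rrefs s by blast
  ultimately show "r = s"
    using pts_rrefs * s by metis
qed

section \<open>The group of the twisted cubic\<close>

text \<open>\<open>w\<close> lists the images of the basis vectors P(infinity), P(0), P(1), P(2);
  from here on a matrix is handled only through these four vectors.\<close>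

definition acts :: "mat \<Rightarrow> vec4 \<times> vec4 \<times> vec4 \<times> vec4 \<Rightarrow> bool" where
  "acts M w \<longleftrightarrow> (\<forall>x. vmat (emb x) M = emb (comb w x))"

lemma length_emb [simp]: "length (emb x) = 4"
  by (cases x) simp

lemma vmat_expand: "vmat x M = map (\<lambda>j. (x ! 0 * M ! 0 ! j + x ! 1 * M ! 1 ! j
    + x ! 2 * M ! 2 ! j + x ! 3 * M ! 3 ! j) mod 3) [0, 1, 2, 3]"
  unfolding vmat_def by (simp add: numeral_eq_Suc lessThan_Suc upt_rec add_ac)

lemma mod_lincomb: "(p0 mod 3 * m0 + p1 mod 3 * m1 + p2 mod 3 * m2 + p3 mod 3 * m3) mod 3 =
    (p0 * m0 + p1 * m1 + p2 * m2 + p3 * m3) mod (3 :: int)"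
  by (intro mod_add_cong mod_mult_cong refl mod_mod_trivial)

lemma vmat_vadd:
  assumes "length x = 4" "length y = 4"
  shows "vmat (vadd x y) M = vadd (vmat x M) (vmat y M)"
proof -
  have "vadd x y ! i = (x ! i + y ! i) mod 3" if "i < 4" for i
    using that assms by (simp add: vadd_def)
  then have "vmat (vadd x y) M = map (\<lambda>j. ((x ! 0 + y ! 0) * M ! 0 ! j + (x ! 1 + y ! 1) * M ! 1 ! j
    + (x ! 2 + y ! 2) * M ! 2 ! j + (x ! 3 + y ! 3) * M ! 3 ! j) mod 3) [0, 1, 2, 3]"
    unfolding vmat_expand by (simp add: mod_lincomb)
  also have "\<dots> = vadd (vmat x M) (vmat y M)"
    unfolding vmat_expand by (simp add: vadd_def mod_simps) (simp add: algebra_simps)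
  finally show ?thesis .
qed

lemma vmat_smul:
  assumes "length x = 4"
  shows "vmat (smul c x) M = smul c (vmat x M)"
proof -
  have "smul c x ! i = (c * x ! i) mod 3" if "i < 4" for i
    using that assms by (simp add: smul_def)
  then have "vmat (smul c x) M = map (\<lambda>j. ((c * x ! 0) * M ! 0 ! j + (c * x ! 1) * M ! 1 ! j
    + (c * x ! 2) * M ! 2 ! j + (c * x ! 3) * M ! 3 ! j) mod 3) [0, 1, 2, 3]"
    unfolding vmat_expand by (simp add: mod_lincomb)
  also have "\<dots> = smul c (vmat x M)"
    unfolding vmat_expand by (simp add: smul_def mod_simps) (simp add: algebra_simps)
  finally show ?thesis .
qed

lemma actsI:
  assumes "vmat (emb e1) M = emb p" "vmat (emb e2) M = emb q"
    "vmat (emb e3) M = emb r" "vmat (emb e4) M = emb s"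
  shows "acts M (p, q, r, s)"
  unfolding acts_def
proof
  fix x
  obtain a b c d where x: "x = V a b c d" by (cases x)
  have mult_F0: "k * F0 = F0" "k * F1 = k" for k by (cases k; simp)+
  have "x = scale a e1 + scale b e2 + scale c e3 + scale d e4"
    by (simp add: x mult_F0)
  then have "emb x = vadd (vadd (vadd (smul (f3_int a) (emb e1)) (smul (f3_int b) (emb e2)))
      (smul (f3_int c) (emb e3))) (smul (f3_int d) (emb e4))"
    by (simp only: smul_emb vadd_emb)
  moreover have "length (vadd y z) = 4" if "length y = 4" "length z = 4" for y z
    using that by (simp add: vadd_def)
  moreover have "length (smul k y) = 4" if "length y = 4" for k y
    using that by (simp add: smul_def)
  ultimately have "vmat (emb x) M = vadd (vadd (vadd (smul (f3_int a) (emb p)) (smul (f3_int b) (emb q)))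
      (smul (f3_int c) (emb r))) (smul (f3_int d) (emb s))"
    by (simp only: vmat_vadd vmat_smul assms length_emb)
  then show "vmat (emb x) M = emb (comb (p, q, r, s) x)"
    by (simp add: x smul_emb vadd_emb)
qed

lemma vmat_in_vecs: "vmat x M \<in> vecs"
proof -
  have "k mod 3 \<in> F3" for k :: int
    using pos_mod_bound[of 3 k] pos_mod_sign[of 3 k] by (simp add: F3_def) presburger
  then show ?thesis by (simp add: vmat_expand vecs_def)
qed

text \<open>\<open>vmat\<close> reduces modulo 3, so the images of the four basis vectors lie in the
  range of \<open>emb\<close>.\<close>

lemma acts_exists: "\<exists>w. acts M w"
  using actsI vmat_in_vecs unfolding vecs_eq by (metis rangeE)

text \<open>The middle rows come from (0,1,0,0) = - P(1) - P(2) - P(0) and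
(0,0,1,0) = P(2) - P(1) - P(\<open>\<infinity>\<close>).\<close>

fun matrix_of :: "vec4 \<times> vec4 \<times> vec4 \<times> vec4 \<Rightarrow> mat" where
  "matrix_of (p, q, r, s) = [emb p, emb (- r - s - q), emb (s - r - p), emb q]"

lemma matrix_of_in_mats: "matrix_of w \<in> mats"
  by (cases w) (auto simp: mats_def vecs_eq)

lemma mod_sum4: "((a mod 3 + b mod 3) mod 3 + (c mod 3 + d mod 3) mod 3) mod 3 = (a + b + c + d) mod (3 :: int)"
  by (simp add: mod_simps add.assoc)

lemma vmat_rows:
  assumes "length r0 = 4" "length r1 = 4" "length r2 = 4" "length r3 = 4"
  shows "vmat [a, b, c, d] [r0, r1, r2, r3] =
    vadd (vadd (smul a r0) (smul b r1)) (vadd (smul c r2) (smul d r3))"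
proof (rule nth_equalityI)
  show "length (vmat [a, b, c, d] [r0, r1, r2, r3]) =
    length (vadd (vadd (smul a r0) (smul b r1)) (vadd (smul c r2) (smul d r3)))"
    using assms by (simp add: vmat_expand vadd_def smul_def)
next
  fix i assume "i < length (vmat [a, b, c, d] [r0, r1, r2, r3])"
  then have i: "i < 4" by (simp add: vmat_def)
  then have "vmat [a, b, c, d] [r0, r1, r2, r3] ! i =
      (a * r0 ! i + b * r1 ! i + c * r2 ! i + d * r3 ! i) mod 3"
    unfolding vmat_def using i
    by (subst nth_map) (simp_all add: eval_nat_numeral lessThan_Suc add_ac del: upt_Suc)
  also have "\<dots> = vadd (vadd (smul a r0) (smul b r1)) (vadd (smul c r2) (smul d r3)) ! i"
    using i assms by (simp add: vadd_def smul_def mod_sum4)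
  finally show "vmat [a, b, c, d] [r0, r1, r2, r3] ! i =
      vadd (vadd (smul a r0) (smul b r1)) (vadd (smul c r2) (smul d r3)) ! i" .
qed

lemma acts_matrix_of: "acts (matrix_of w) w"
proof -
  obtain p q r s where w: "w = (p, q, r, s)" by (metis prod.exhaust)
  have smul_0: "smul 0 (emb x) = emb 0" for x
    using smul_emb[of F0 x] by simp
  have "vmat (emb e1) (matrix_of w) = emb p"
    "vmat (emb e2) (matrix_of w) = emb q"
    by (simp_all add: w vmat_rows smul_0 vadd_emb del: emb_0)
  moreover
  \<comment> \<open>P(1) = (1,1,1,1) and P(2) = (-1,1,-1,1) combine the rows with these signs; in
    characteristic 3 the results are \<open>r\<close> and \<open>s\<close>.\<close>
  have "p + (- r - s - q) + (s - r - p + q) = - (r + r)"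
    "- p + (- r - s - q) + (- (s - r - p) + q) = - (s + s)"
    by (simp_all add: algebra_simps del: vec4_double)
  then have "p + (- r - s - q) + (s - r - p + q) = r"
    "- p + (- r - s - q) + (- (s - r - p) + q) = s"
    by simp_all
  then have "vmat (emb e3) (matrix_of w) = emb r"
    "vmat (emb e4) (matrix_of w) = emb s"
    by (simp_all add: w vmat_rows smul_0 vadd_emb del: emb_0)
  ultimately show ?thesis
    unfolding w by (intro actsI) auto
qed

lemma scale_add: "scale k (x + y) = scale k x + scale k y"
  by (cases x; cases y) (simp add: distrib_left)

lemma scale_add_left: "scale (k + l) x = scale k x + scale l x"
  by (cases x) (simp add: distrib_right)

lemma comb_add: "comb w (x + y) = comb w x + comb w y"
  by (cases w; cases x; cases y) (simp add: scale_add_left add_ac)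

lemma comb_uminus: "comb w (- x) = - comb w x"
proof -
  have "comb w 0 = 0" by (cases w) (simp add: zero_vec4_def)
  then have "comb w x + comb w (- x) = 0" by (simp flip: comb_add)
  then show ?thesis by (simp add: add_eq_0_iff)
qed

lemma comb_diff: "comb w (x - y) = comb w x - comb w y"
  using comb_add[of w x "- y"] by (simp add: comb_uminus)

lemma proj_pnt: "acts M w \<Longrightarrow> proj M (pnt x) = pnt (comb w x)"
  by (simp add: proj_def pnt_eq acts_def comb_uminus)

lemma proj_ln4: "acts M w \<Longrightarrow> proj M ` ln4 (u, v) = ln4 (comb w u, comb w v)"
  by (simp add: proj_pnt comb_add comb_diff)

lemma proj_image_pair: "acts M w \<Longrightarrow> proj M ` ln4 r = ln4 (image_pair w r)"
  by (cases r) (simp add: proj_ln4 ln4_canon del: ln4.simps canon.simps)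

lemma nonsingular_iff: "acts M w \<Longrightarrow> nonsingular M \<longleftrightarrow> (\<forall>x. comb w x = 0 \<longrightarrow> x = 0)"
  unfolding nonsingular_def vecs_eq by (simp add: acts_def)

lemma Cub_eq: "Cub = pnt ` set units"
proof -
  have "Pc None = pnt e1" "Pc (Some (f3_int F0)) = pnt e2"
    "Pc (Some (f3_int F1)) = pnt e3" "Pc (Some (f3_int F2)) = pnt e4"
    by (simp_all add: Pc_def pnt_def)
  moreover have "Cub = {Pc None, Pc (Some (f3_int F0)), Pc (Some (f3_int F1)), Pc (Some (f3_int F2))}"
    by (auto simp: Cub_def Fplus_def F3_def)
  ultimately show ?thesis by (simp add: units_def)
qed

section \<open>Monomial maps and Hamming weight\<close>

definition signed_units :: "vec4 list" where
  "signed_units = units @ map uminus units"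

definition monomial :: "vec4 \<times> vec4 \<times> vec4 \<times> vec4 \<Rightarrow> bool" where
  "monomial w \<longleftrightarrow> (case w of (p, q, r, s) \<Rightarrow>
     set [p, q, r, s] \<subseteq> set signed_units \<and> distinct (map pnt [p, q, r, s]))"

lemma wt_V: "wt (V a b c d) = (if a = F0 then 0 else 1) + (if b = F0 then 0 else 1)
    + (if c = F0 then 0 else 1) + (if d = F0 then 0 else 1)"
  by simp

lemma f3_uminus_eq_F0 [simp]: "- a = F0 \<longleftrightarrow> a = F0"
  by (cases a; simp)

lemma f3_mult_simps [simp]: "k * F0 = F0" "k * F1 = k" "k * F2 = - k"
  by (cases k; simp)+

lemma wt_uminus [simp]: "wt (- x) = wt x"
  by (cases x) (simp add: wt_V del: wt.simps)

lemma wt_eq_0_iff: "wt x = 0 \<longleftrightarrow> x = 0"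
  by (cases x) (simp add: zero_vec4_def)

lemma wt_comb_units:
  assumes "set [p, q, r, s] \<subseteq> set units" "distinct [p, q, r, s]"
  shows "wt (comb (p, q, r, s) (V a b c d)) = wt (V a b c d)"
  using assms
  by (simp add: units_def del: wt.simps)
    (elim conjE disjE; simp add: wt_V add_ac del: wt.simps)

lemma signed_units_scale:
  "y \<in> set signed_units \<Longrightarrow> \<exists>k e. k \<noteq> F0 \<and> e \<in> set units \<and> y = scale k e"
  by (auto simp: signed_units_def)

lemma pnt_scale: "k \<noteq> F0 \<Longrightarrow> pnt (scale k x) = pnt x"
  by (cases k) auto

text \<open>The signs are moved from the images into the coordinates, where nonzero factors leave
  the zero pattern alone; a permutation of the units remains.\<close>

lemma wt_comb_monomial:
  assumes "monomial w"
  shows "wt (comb w x) = wt x"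
proof -
  obtain p q r s where w: "w = (p, q, r, s)" by (metis prod.exhaust)
  obtain a b c d where x: "x = V a b c d" by (cases x)
  have "p \<in> set signed_units" "q \<in> set signed_units" "r \<in> set signed_units" "s \<in> set signed_units"
    using assms by (auto simp: w monomial_def)
  then obtain k1 k2 k3 k4 p' q' r' s' where k: "k1 \<noteq> F0" "k2 \<noteq> F0" "k3 \<noteq> F0" "k4 \<noteq> F0"
    and p': "set [p', q', r', s'] \<subseteq> set units"
    and pp': "p = scale k1 p'" "q = scale k2 q'" "r = scale k3 r'" "s = scale k4 s'"
    using signed_units_scale by (metis (no_types, lifting) empty_subsetI empty_set insert_subset list.simps(15))
  have "distinct [p', q', r', s']"
    using assms k by (auto simp: w monomial_def pp' pnt_scale)
  moreover have "comb w x = comb (p', q', r', s') (V (a * k1) (b * k2) (c * k3) (d * k4))"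
  proof -
    have "scale a (scale k y) = scale (a * k) y" for a k y
      by (cases y) (simp add: mult.assoc)
    then show ?thesis by (simp add: w x pp')
  qed
  moreover have "wt (V (a * k1) (b * k2) (c * k3) (d * k4)) = wt x"
  proof -
    have "y * k = F0 \<longleftrightarrow> y = F0" if "k \<noteq> F0" for y k
      using that by (cases y; cases k; simp)
    then show ?thesis by (simp add: x wt_V k del: wt.simps)
  qed
  ultimately show ?thesis using wt_comb_units[OF p'] by metis
qed

text \<open>Stability of the cubic makes each basis image a signed unit, and nonsingularity keeps
  the four image points apart.\<close>

lemma monomial_if_G3:
  assumes "M \<in> G3" "acts M w"
  shows "monomial w"
proof -
  obtain p q r s where w: "w = (p, q, r, s)" by (metis prod.exhaust)
  have e: "comb w e1 = p" "comb w e2 = q" "comb w e3 = r" "comb w e4 = s"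
    by (simp_all add: w)
  have "pnt ` set units = proj M ` pnt ` set units"
    using assms(1) by (simp add: G3_def Cub_eq)
  also have "\<dots> = pnt ` {p, q, r, s}"
    using e by (simp add: units_def proj_pnt[OF assms(2)])
  finally have "pnt ` {p, q, r, s} = pnt ` set units" by simp
  then have "y \<in> set signed_units" if "y \<in> {p, q, r, s}" for y
  proof -
    have "pnt y \<in> pnt ` set units"
      using that \<open>pnt ` {p, q, r, s} = pnt ` set units\<close> by blast
    then show ?thesis
      by (auto simp: signed_units_def pnt_eq_iff)
  qed
  moreover have "pnt (comb w x) \<noteq> pnt (comb w y)" if "x \<noteq> y" "x \<noteq> - y" for x y
  proof
    have ns: "z = 0" if "comb w z = 0" for z
      using assms that by (auto simp: G3_def nonsingular_iff)
    assume "pnt (comb w x) = pnt (comb w y)"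
    then have "comb w (x - y) = 0 \<or> comb w (x + y) = 0"
      by (auto simp: pnt_eq_iff comb_diff comb_add)
    then have "x - y = 0 \<or> x + y = 0" using ns by blast
    then show False using that by (auto simp: add_eq_0_iff2)
  qed
  from this[of e1 e2] this[of e1 e3] this[of e1 e4] this[of e2 e3] this[of e2 e4] this[of e3 e4]
  have "distinct (map pnt [p, q, r, s])" by (simp add: e)
  ultimately show ?thesis by (auto simp: monomial_def w)
qed

text \<open>Read off from the line itself, hence independent of the spanning pair; this is why
  \<open>canon\<close> does not disturb the weights in \<open>wts_image_pair\<close>.\<close>

definition wtset :: "vec set set \<Rightarrow> nat set" where
  "wtset L = {wt x | x. pnt x \<in> L}"

lemma wtset_ln4: "wtset (ln4 r) = wts r"
  by (auto simp: wtset_def wts_def ln4_pts pnt_eq_iff image_iff)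

lemma wts_image_pair:
  assumes "M \<in> G3" "acts M w"
  shows "wts (image_pair w r) = wts r"
proof -
  obtain u v where r: "r = (u, v)" by force
  have "wts (image_pair w r) = wtset (ln4 (comb w u, comb w v))"
    by (simp only: r image_pair.simps ln4_canon flip: wtset_ln4)
  also have "\<dots> = wts (comb w u, comb w v)" by (rule wtset_ln4)
  also have "\<dots> = wts r"
    using wt_comb_monomial[OF monomial_if_G3[OF assms]]
    by (simp add: wts_def r flip: comb_add comb_diff)
  finally show ?thesis .
qed

section \<open>Connecting lines by elements of G_3\<close>

definition linked :: "vec4 \<times> vec4 \<Rightarrow> vec4 \<times> vec4 \<Rightarrow> bool" where
  "linked r s \<longleftrightarrow> (\<exists>M\<in>G3. proj M ` ln4 r = ln4 s)"

text \<open>No matrix product is formed: \<open>matrix_of\<close> rebuilds the composite from the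
  images of the basis vectors, which places it in \<open>mats\<close> at once.\<close>

lemma linked_trans:
  assumes "linked r s" "linked s t"
  shows "linked r t"
proof -
  obtain M N where MN: "M \<in> G3" "N \<in> G3" "proj M ` ln4 r = ln4 s" "proj N ` ln4 s = ln4 t"
    using assms by (auto simp: linked_def)
  obtain w w' where w: "acts M w" "acts N w'" using acts_exists by blast
  obtain p1 p2 p3 p4 where p: "w = (p1, p2, p3, p4)" by (metis prod.exhaust)
  \<comment> \<open>\<open>comb_diff\<close> at 0, 0 gives \<open>comb w' 0 = 0\<close>, which is
    the case \<open>k = F0\<close>.\<close>
  have *: "comb w' (scale k y) = scale k (comb w' y)" for k y
    using f3_cases[of k] comb_diff[of w' 0 0] by (auto simp: comb_uminus)
  define w'' where "w'' = (comb w' p1, comb w' p2, comb w' p3, comb w' p4)"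
  have comb: "comb w'' x = comb w' (comb w x)" for x
    by (cases x) (simp add: p w''_def comb_add *)
  define K where "K = matrix_of w''"
  have aK: "acts K w''"
    unfolding K_def by (rule acts_matrix_of)
  have pnts: "proj K ` A = proj N ` proj M ` A" if "A \<subseteq> range pnt" for A
  proof -
    have "proj K a = proj N (proj M a)" if "a \<in> A" for a
      using \<open>A \<subseteq> range pnt\<close> that by (auto simp: proj_pnt[OF aK] proj_pnt[OF w(1)] proj_pnt[OF w(2)] comb)
    then show ?thesis by (simp add: image_image)
  qed
  have "nonsingular K"
    unfolding nonsingular_iff[OF aK] comb
    using MN(1,2) nonsingular_iff[OF w(1)] nonsingular_iff[OF w(2)] unfolding G3_def by blast
  moreover have "proj K ` Cub = Cub"
    using MN(1,2) by (simp add: pnts Cub_eq image_mono G3_def)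
  ultimately have "K \<in> G3"
    by (simp add: G3_def K_def matrix_of_in_mats)
  moreover have "ln4 r \<subseteq> range pnt" by (auto simp: ln4_pts)
  then have "proj K ` ln4 r = ln4 t" by (simp add: pnts MN)
  ultimately show ?thesis by (auto simp: linked_def)
qed

lemma set_gensE:
  assumes "w \<in> set gens"
  obtains "w = (- e1, e2, e3, e4)" | "w = (e2, e1, e3, e4)" | "w = (e1, e3, e2, e4)" | "w = (e1, e2, e4, e3)"
  using assms by (auto simp: gens_def)

lemma gens_in_G3:
  assumes "w \<in> set gens"
  shows "matrix_of w \<in> G3"
proof -
  have "monomial w"
    using assms by (auto simp: gens_def monomial_def signed_units_def units_def pnt_eq_iff)
  \<comment> \<open>A kernel vector has an image of weight 0, hence weight 0 itself.\<close>
  then have "nonsingular (matrix_of w)"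
    unfolding nonsingular_iff[OF acts_matrix_of] using wt_comb_monomial wt_eq_0_iff by metis
  moreover have "proj (matrix_of w) ` Cub = Cub"
    using assms unfolding Cub_eq units_def
    by (elim set_gensE)
      (simp_all add: proj_pnt[OF acts_matrix_of] insert_commute pnt_uminus[of e1, simplified]
        del: matrix_of.simps)
  ultimately show ?thesis
    by (simp add: G3_def matrix_of_in_mats)
qed

lemma linked_gens:
  assumes "w \<in> set gens"
  shows "linked r (image_pair w r)" "linked (image_pair w r) r"
proof -
  have im: "proj (matrix_of w) ` ln4 r = ln4 (image_pair w r)"
    by (rule proj_image_pair[OF acts_matrix_of])
  then show "linked r (image_pair w r)"
    using gens_in_G3[OF assms] by (auto simp: linked_def)
  have "comb w (comb w x) = x" for x
    using assms by (cases x) (auto simp: gens_def)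
  then have "proj (matrix_of w) (proj (matrix_of w) (pnt x)) = pnt x" for x
    by (simp add: proj_pnt[OF acts_matrix_of])
  then have "proj (matrix_of w) ` proj (matrix_of w) ` ln4 r = ln4 r"
    unfolding ln4_pts by (simp add: image_image)
  then show "linked (image_pair w r) r"
    using gens_in_G3[OF assms] im by (auto simp: linked_def)
qed

lemma grow_invariant:
  assumes step: "\<And>r w. Q r \<Longrightarrow> w \<in> set gens \<Longrightarrow> Q (image_pair w r)"
  shows "\<forall>s\<in>set seen \<union> set front. Q s \<Longrightarrow> s \<in> set (grow n (seen, front)) \<Longrightarrow> Q s"
proof (induction n arbitrary: seen front)
  case (Suc n)
  have "\<forall>s\<in>set (new_images seen front). Q s"
    using Suc.prems(1) step by (auto simp: new_images_def)
  then show ?case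
    using Suc.IH[of "new_images seen front @ seen" "new_images seen front"] Suc.prems by auto
qed simp

text \<open>The identity arises as the square of a generator.\<close>

lemma linked_refl: "linked r r"
  using linked_trans[OF linked_gens(1)[of "hd gens" r] linked_gens(2)[of "hd gens" r]]
  by (simp add: gens_def)

text \<open>Both directions are carried through the search because reversal is established only for
  single generators.\<close>

lemma linked_grow: "s \<in> set (grow n ([r], [r])) \<Longrightarrow> linked r s \<and> linked s r"
  by (rule grow_invariant[where Q = "\<lambda>s. linked r s \<and> linked s r"])
    (auto intro: linked_refl linked_trans linked_gens)

lemma comb_monomial_eq_0_iff: "monomial w \<Longrightarrow> comb w x = 0 \<longleftrightarrow> x = 0"
  using wt_comb_monomial wt_eq_0_iff by metis

lemma linked_same_wts:
  assumes "r \<in> set rrefs" "s \<in> set rrefs" "wts r = wts s"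
  shows "linked r s"
proof -
  have "wts r \<in> set (map wts reps)"
    using assms(1) wts_in_profiles wts_reps by simp
  then obtain t where t: "t \<in> set reps" "wts r = wts t" by auto
  then have "covered t" using covered_reps by blast
  then have "x \<in> set (grow 9 ([t], [t]))" if "x \<in> set rrefs" "wts x = wts t" for x
    using that by (cases t) auto
  then have "linked r t" "linked t s"
    using linked_grow assms t by metis+
  then show ?thesis by (rule linked_trans)
qed

section \<open>Line types as sets of echelon forms\<close>

text \<open>By injectivity of \<open>ln4\<close> on \<open>rrefs\<close>, Boolean operations and
  cardinalities of such sets of lines turn into operations on predicates and lengths of filtered
  lists.\<close>

definition rclass :: "(vec4 \<times> vec4 \<Rightarrow> bool) \<Rightarrow> vec set set set" where
  "rclass P = ln4 ` set (filter P rrefs)"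

text \<open>Invariance of the weight set bounds the orbit from above, \<open>linked_same_wts\<close>
  from below.\<close>

lemma Gorbit_G3:
  assumes r: "r \<in> set rrefs"
  shows "Gorbit G3 (ln4 r) = rclass (\<lambda>s. wts s = wts r)"
proof
  show "rclass (\<lambda>s. wts s = wts r) \<subseteq> Gorbit G3 (ln4 r)"
  proof
    fix L assume "L \<in> rclass (\<lambda>s. wts s = wts r)"
    then obtain s where s: "s \<in> set rrefs" "wts s = wts r" "L = ln4 s"
      by (auto simp: rclass_def)
    then have "linked r s" using linked_same_wts[OF r] by simp
    then show "L \<in> Gorbit G3 (ln4 r)"
      using s(3) unfolding linked_def Gorbit_def by blast
  qed
  show "Gorbit G3 (ln4 r) \<subseteq> rclass (\<lambda>s. wts s = wts r)"
  proof
    fix L assume "L \<in> Gorbit G3 (ln4 r)"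
    then obtain M where M: "M \<in> G3" "L = proj M ` ln4 r" by (auto simp: Gorbit_def)
    obtain w where w: "acts M w" using acts_exists by blast
    obtain u v where uv: "r = (u, v)" by force
    have zero: "comb w x = 0 \<longleftrightarrow> x = 0" for x
      using comb_monomial_eq_0_iff monomial_if_G3 M w by blast
    have "comb w x = comb w y \<longleftrightarrow> x = y" for x y
      using zero[of "x - y"] by (simp add: comb_diff)
    \<comment> \<open>Independence shows that the image is again a line, so that it has an echelon
      form to which weights can be assigned.\<close>
    then have "indep (comb w u) (comb w v)"
      using indep_rrefs[of u v] r by (simp add: uv indep_def zero flip: comb_uminus)
    then have "L \<in> Lines"
      unfolding Lines_eq_indep M uv proj_ln4[OF w] by blast
    then obtain s where s: "s \<in> set rrefs" "L = ln4 s" by (auto simp: Lines_eq)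
    have "wts s = wts r"
      using M w s by (metis proj_image_pair wts_image_pair wtset_ln4)
    then show "L \<in> rclass (\<lambda>s. wts s = wts r)"
      using s by (auto simp: rclass_def)
  qed
qed

lemma rclass_eqI:
  assumes "\<And>L. P L \<Longrightarrow> L \<in> Lines" "\<And>r. r \<in> set rrefs \<Longrightarrow> P (ln4 r) \<longleftrightarrow> Q r"
  shows "{L. P L} = rclass Q"
  using assms unfolding Lines_eq rclass_def by force

lemma card_rclass: "card (rclass P) = length (filter P rrefs)"
proof -
  have "card (rclass P) = card (set (filter P rrefs))"
    unfolding rclass_def by (rule card_image) (rule inj_on_subset[OF inj_on_ln4], auto)
  then show ?thesis
    using distinct_card[OF distinct_filter[OF distinct_rrefs, of P]] by simp
qed

lemma rclass_cong: "(\<And>r. r \<in> set rrefs \<Longrightarrow> P r \<longleftrightarrow> Q r) \<Longrightarrow> rclass P = rclass Q"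
  unfolding rclass_def by (metis filter_cong)

lemma rclass_Un: "rclass P \<union> rclass Q = rclass (\<lambda>r. P r \<or> Q r)"
  unfolding rclass_def by auto

lemma rclass_Diff: "rclass P - rclass Q = rclass (\<lambda>r. P r \<and> \<not> Q r)"
  unfolding rclass_def using inj_on_ln4 by (auto dest: inj_onD)

lemma in_rclass: "r \<in> set rrefs \<Longrightarrow> ln4 r \<in> rclass P \<longleftrightarrow> P r"
  unfolding rclass_def using inj_on_ln4 by (auto dest: inj_onD)

lemma units_points4: "set units \<subseteq> set points4"
  by (simp add: units_def set_points4)

lemma inter_Cub:
  assumes "r \<in> set rrefs"
  shows "ln4 r \<inter> Cub = pnt ` set (filter (\<lambda>e. e \<in> set (pts r)) units)"
  unfolding Cub_eq using pnt_in_ln4[OF assms] units_points4 by fastforce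

lemma card_inter_Cub:
  assumes "r \<in> set rrefs"
  shows "card (ln4 r \<inter> Cub) = ncub r"
proof -
  have "card (ln4 r \<inter> Cub) = card (set (filter (\<lambda>e. e \<in> set (pts r)) units))"
    unfolding inter_Cub[OF assms]
    by (rule card_image) (rule inj_on_subset[OF inj_on_pnt], use units_points4 in auto)
  also have "\<dots> = length (filter (\<lambda>e. e \<in> set (pts r)) units)"
    by (rule distinct_card) (simp add: units_def)
  finally show ?thesis by (cases r) simp
qed

lemma finite_ln4 [simp]: "finite (ln4 r)"
  by (cases r) simp

lemma RC_ln4:
  assumes "r \<in> set rrefs"
  shows "RC (ln4 r) \<longleftrightarrow> 2 \<le> ncub r"
proof -
  have "RC (ln4 r) \<longleftrightarrow> \<not> card (ln4 r \<inter> Cub) \<le> Suc 0"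
    using assms by (subst card_le_Suc0_iff_eq) (auto simp: RC_def Lines_eq)
  then show ?thesis by (simp add: card_inter_Cub[OF assms] not_le Suc_le_eq numeral_2_eq_2)
qed

lemma tangents_points4: "(p, q) \<in> set tangents \<Longrightarrow> p \<in> set points4 \<and> q \<in> set points4"
  by (auto simp: tangents_def set_points4)

lemma Tr_ln4:
  assumes "r \<in> set rrefs"
  shows "Tr (ln4 r) \<longleftrightarrow> tangent_rref r"
proof -
  have "Pc (Some 0) = pnt e2" "Pc (Some 1) = pnt e3" "Pc (Some 2) = pnt e4"
    "pt [1, 0, 0, 0] = pnt e1"
    by (simp_all add: Pc_def pnt_def)
  moreover have "pt [0, 0, 1, 0] = pnt (- V F1 F0 F1 F2)" "pt [0, 2, 1, 0] = pnt (- V F1 F2 F0 F1)"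
    "pt [0, 1, 1, 0] = pnt (- V F1 F1 F2 F0)" "pt [0, 1, 0, 0] = pnt (- V F0 F1 F1 F1)"
    by (simp_all add: pnt_def del: pnt_uminus)
  then have "pt [0, 0, 1, 0] = pnt (V F1 F0 F1 F2)" "pt [0, 2, 1, 0] = pnt (V F1 F2 F0 F1)"
    "pt [0, 1, 1, 0] = pnt (V F1 F1 F2 F0)" "pt [0, 1, 0, 0] = pnt (V F0 F1 F1 F1)"
    by (simp_all only: pnt_uminus)
  ultimately have "Tr (ln4 r) \<longleftrightarrow> list_ex (\<lambda>(p, q). pnt p \<in> ln4 r \<and> pnt q \<in> ln4 r) tangents"
    using assms by (simp add: Tr_def F3_def tangents_def Lines_eq disj_ac)
  also have "\<dots> \<longleftrightarrow> list_ex (on_both r) tangents"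
  proof -
    have "(case x of (p, q) \<Rightarrow> pnt p \<in> ln4 r \<and> pnt q \<in> ln4 r) \<longleftrightarrow> on_both r x"
      if "x \<in> set tangents" for x
    proof (cases x)
      case (Pair p q)
      then have "p \<in> set points4" "q \<in> set points4"
        using that tangents_points4 by blast+
      then show ?thesis
        using pnt_in_ln4[OF assms] by (simp add: Pair on_both_def)
    qed
    then show ?thesis unfolding list_ex_iff by blast
  qed
  finally show ?thesis by (cases r) simp
qed

section \<open>Planes, UG-lines and lines meeting the Ar-line\<close>

lemma form_uminus: "form k (- x) = - form k x"
  by (cases k; cases x) (simp add: algebra_simps)

lemma dot_emb:
  "dot [f3_int k0, f3_int k1, f3_int k2, f3_int k3] (emb x) = f3_int (form (k0, k1, k2, k3) x)"
proof (cases x)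
  case (V a b c d)
  have lin: "f3_int (k0 * p + k1 * q + k2 * r + k3 * s) =
      (f3_int k0 * f3_int p + f3_int k1 * f3_int q + f3_int k2 * f3_int r + f3_int k3 * f3_int s) mod 3"
    for p q r s
    by (simp add: f3_int_add f3_int_mult mod_simps)
  have "dot [f3_int k0, f3_int k1, f3_int k2, f3_int k3] (emb x) =
    (f3_int k0 * f3_int (a + c - d) + f3_int k1 * f3_int (c + d) + f3_int k2 * f3_int (c - d)
      + f3_int k3 * f3_int (b + c + d)) mod 3"
    by (simp add: V dot_def numeral_eq_Suc lessThan_Suc add_ac)
  also have "\<dots> = f3_int (form (k0, k1, k2, k3) x)"
    by (simp only: V form.simps lin)
  finally show ?thesis .
qed

definition plane4 :: "f3 \<times> f3 \<times> f3 \<times> f3 \<Rightarrow> vec set set" where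
  "plane4 k = {pnt x | x. x \<noteq> 0 \<and> form k x = F0}"

lemma pnt_in_plane4: "x \<noteq> 0 \<Longrightarrow> pnt x \<in> plane4 k \<longleftrightarrow> form k x = F0"
  by (auto simp: plane4_def pnt_eq_iff form_uminus)

lemma plane_eq: "plane [f3_int k0, f3_int k1, f3_int k2, f3_int k3] = plane4 (k0, k1, k2, k3)"
  unfolding plane_def vecs_eq plane4_def pnt_def by (force simp: dot_emb)

lemma planes:
  "plane [1,0,0,0] = plane4 (F1,F0,F0,F0)" "plane [0,0,0,1] = plane4 (F0,F0,F0,F1)"
  "plane [0,1,1,0] = plane4 (F0,F1,F1,F0)" "plane [0,1,0,1] = plane4 (F0,F1,F0,F1)"
  "plane [0,0,1,0] = plane4 (F0,F0,F1,F0)" "plane [1,0,-1,0] = plane4 (F1,F0,F2,F0)"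
  "plane [1,0,0,1] = plane4 (F1,F0,F0,F1)" "plane [1,0,0,2] = plane4 (F1,F0,F0,F2)"
proof -
  \<comment> \<open>The coefficient -1 is outside the range of \<open>f3_int\<close>, so it is first
    replaced by 2.\<close>
  have "(a - b) mod 3 = (a + 2 * b) mod 3" for a b :: int by presburger
  then have "plane [1,0,-1,0] = plane [1,0,2,0]"
    by (simp add: plane_def dot_def numeral_eq_Suc lessThan_Suc add_ac)
  then show "plane [1,0,-1,0] = plane4 (F1,F0,F2,F0)"
    by (simp flip: plane_eq)
qed (simp_all flip: plane_eq)

lemma GammaPlanes_eq: "GammaPlanes = plane4 ` set gamma_forms"
proof -
  have "osc None = plane4 (F0,F0,F0,F1)" "osc (Some 0) = plane4 (F1,F0,F0,F0)"
    "osc (Some 1) = plane4 (F1,F0,F0,F2)" "osc (Some 2) = plane4 (F1,F0,F0,F1)"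
    by (simp_all add: osc_def flip: planes)
  then show ?thesis
    by (simp add: GammaPlanes_def Fplus_def F3_def gamma_forms_def insert_commute)
qed

lemma points4_neq_0: "x \<in> set points4 \<Longrightarrow> x \<noteq> 0"
  by (auto simp: set_points4 zero_vec4_def)

lemma ln4_subset_plane4:
  assumes "r \<in> set rrefs"
  shows "ln4 r \<subseteq> plane4 k \<longleftrightarrow> list_all (\<lambda>p. form k p = F0) (pts r)"
proof -
  have "pnt p \<in> plane4 k \<longleftrightarrow> form k p = F0" if "p \<in> set (pts r)" for p
    using that pts_points4[OF assms] points4_neq_0 pnt_in_plane4 by blast
  then show ?thesis
    unfolding ln4_pts list_all_iff image_subset_iff by blast
qed

lemma UG_ln4:
  assumes "r \<in> set rrefs"
  shows "UG (ln4 r) \<longleftrightarrow> ug_rref r"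
  using assms by (simp add: UG_def ug_rref_def unisecant_def card_inter_Cub Tr_ln4 GammaPlanes_eq
      ln4_subset_plane4 Lines_eq list_ex_iff)

lemma plane4_Int: "plane4 k \<inter> plane4 k' = pnt ` set (meet k k')"
proof
  show "plane4 k \<inter> plane4 k' \<subseteq> pnt ` set (meet k k')"
  proof
    fix p assume p: "p \<in> plane4 k \<inter> plane4 k'"
    then obtain x where x: "x \<noteq> 0" "p = pnt x" by (auto simp: plane4_def)
    let ?y = "normalise x"
    have "?y \<noteq> 0" "p = pnt ?y" using x by auto
    then have "form k ?y = F0" "form k' ?y = F0"
      using p by (auto simp: pnt_in_plane4 simp del: pnt_normalise)
    then have "?y \<in> set (meet k k')"
      using x by (simp add: meet_def set_points4 lead_coeff4_normalise)
    then show "p \<in> pnt ` set (meet k k')" using \<open>p = pnt ?y\<close> by blast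
  qed
  show "pnt ` set (meet k k') \<subseteq> plane4 k \<inter> plane4 k'"
    using points4_neq_0 by (auto simp: meet_def plane4_def)
qed

lemma base_lines:
  "plane [0,1,1,0] \<inter> plane [0,1,0,1] = ln4 un1_rref"
  "plane [0,0,1,0] \<inter> plane [0,1,0,1] = ln4 un2_rref"
  "plane [1,0,0,0] \<inter> plane [0,1,0,1] = ln4 ea2_rref"
  "plane [1,0,-1,0] \<inter> plane [0,0,0,1] = ln4 ea3_rref"
  "plane [1,0,-1,0] \<inter> plane [0,1,0,1] = ln4 en3_rref"
  "plane [1,0,0,0] \<inter> plane [0,0,0,1] = ln4 ar_rref"
  by (simp_all only: planes plane4_Int set_meet ln4_pts)

lemma ArLine_eq: "ArLine = ln4 ar_rref"
  by (simp only: ArLine_def base_lines)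

lemma ar_rref_in_rrefs: "ar_rref \<in> set rrefs"
  by (rule is_rref_imp_rrefs) (simp add: ar_rref_def)

lemma external_ln4: "r \<in> set rrefs \<Longrightarrow> external (ln4 r) \<longleftrightarrow> ncub r = 0"
  by (simp add: external_def Lines_eq flip: card_inter_Cub)

lemma inter_ArLine:
  assumes "r \<in> set rrefs"
  shows "ln4 r \<inter> ArLine = pnt ` (set (pts r) \<inter> set (pts ar_rref))"
  unfolding ArLine_eq ln4_pts
  using pts_points4[OF assms] pts_points4[OF ar_rref_in_rrefs] inj_on_pnt
  by (metis inj_on_image_Int)

lemma EA_ln4:
  assumes "r \<in> set rrefs"
  shows "EA (ln4 r) \<longleftrightarrow> ea_rref r"
proof -
  have "ln4 r = ArLine \<longleftrightarrow> r = ar_rref"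
    using assms ar_rref_in_rrefs inj_on_ln4 by (auto simp: ArLine_eq dest: inj_onD)
  then show ?thesis
    using assms by (auto simp: EA_def ea_rref_def external_ln4 inter_ArLine list_ex_iff)
qed

section \<open>Imaginary chords over F_9\<close>

definition span2 :: "vec4 \<Rightarrow> vec4 \<Rightarrow> vec4 set" where
  "span2 x y = {scale a x + scale b y | a b. True}"

lemma emb_comb_nth:
  "j < 4 \<Longrightarrow> emb (scale a x + scale b y) ! j = (f3_int a * emb x ! j + f3_int b * emb y ! j) mod 3"
  by (simp add: vadd_def smul_def mod_simps flip: smul_emb vadd_emb)

lemma emb_eq_nth_iff: "p = q \<longleftrightarrow> (\<forall>j<4. emb p ! j = emb q ! j)"
  using nth_equalityI[of "emb p" "emb q"] by auto

lemma bex_F9: "(\<exists>z\<in>F9. P z) \<longleftrightarrow> (\<exists>a b. P (f3_int a, f3_int b))"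
  by (auto simp: F9_def f3_int_range)

text \<open>\<open>zip\<close> encodes \<open>p + q i\<close>. As \<open>x\<close> and
  \<open>y\<close> have entries in F_3, a combination with coefficients in F_9 separates into its
  real and imaginary parts.\<close>

lemma inF9span_iff:
  "inF9span (emb x) (emb y) (zip (emb p) (emb q)) \<longleftrightarrow> p \<in> span2 x y \<and> q \<in> span2 x y"
proof -
  have "(\<forall>j<4. f9add (f9mul (f3_int a, f3_int a') (emb x ! j, 0)) (f9mul (f3_int b, f3_int b') (emb y ! j, 0))
        = zip (emb p) (emb q) ! j)
      \<longleftrightarrow> p = scale a x + scale b y \<and> q = scale a' x + scale b' y" for a a' b b'
  proof -
    have "f9add (f9mul (f3_int a, f3_int a') (emb x ! j, 0)) (f9mul (f3_int b, f3_int b') (emb y ! j, 0))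
        = (emb (scale a x + scale b y) ! j, emb (scale a' x + scale b' y) ! j)" if "j < 4" for j
      by (simp add: emb_comb_nth[OF that] f9add_def f9mul_def mod_simps)
    then show ?thesis
      by (auto simp: emb_eq_nth_iff)
  qed
  moreover have "inF9span (emb x) (emb y) w \<longleftrightarrow> (\<exists>a a' b b'. \<forall>j<4.
      f9add (f9mul (f3_int a, f3_int a') (emb x ! j, 0)) (f9mul (f3_int b, f3_int b') (emb y ! j, 0)) = w ! j)"
    for w
    unfolding inF9span_def bex_F9 by blast
  ultimately show ?thesis
    unfolding span2_def by blast
qed

text \<open>Real and imaginary part of P(\<open>\<alpha>\<close>) for \<open>\<alpha>\<close> = a + b i with b^2 = 1, using
\<open>\<alpha>\<close>^2 = a^2 - 1 + 2 a b i and \<open>\<alpha>\<close>^3 = a - b i.\<close>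

definition re_cub :: "f3 \<Rightarrow> vec4" where
  "re_cub a = V F0 (F2 - a * a) (F1 - a - a * a) (F1 + a - a * a)"

definition im_cub :: "f3 \<Rightarrow> f3 \<Rightarrow> vec4" where
  "im_cub a b = V b (a * b) (a * b - b) (a * b + b)"

lemma f9pow_simps: "f9pow x 2 = f9mul x (f9mul x (1, 0))" "f9pow x 3 = f9mul x (f9mul x (f9mul x (1, 0)))"
  by (simp_all add: f9pow_def numeral_eq_Suc)

lemma Pc9_eq:
  assumes "b \<noteq> F0"
  shows "Pc9 (f3_int a, f3_int b) = zip (emb (re_cub a)) (emb (im_cub a b))"
    and "f9pow (f3_int a, f3_int b) 3 = (f3_int a, f3_int (- b))"
  using assms
  by (cases a; cases b; simp add: Pc9_def f9pow_simps f9mul_def re_cub_def im_cub_def)+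

lemma pnt_ln4_iff_span2:
  assumes "indep u v"
  shows "x \<noteq> 0 \<Longrightarrow> pnt x \<in> ln4 (u, v) \<longleftrightarrow> x \<in> span2 u v"
    and "pnt x \<in> ln4 (u, v) \<Longrightarrow> x \<in> span2 u v"
proof -
  have *: "{scale a u + scale b v | a b. True} =
     {0, u, v, u + v, u - v, - u, - v, - (u + v), - (u - v)}" (is "?A = ?B")
  proof
    have "scale a u + scale b v \<in> ?B" for a b
      by (cases a; cases b; simp)
    then show "?A \<subseteq> ?B" by blast
    have "scale F0 u + scale F0 v \<in> ?A" "scale F1 u + scale F0 v \<in> ?A" "scale F0 u + scale F1 v \<in> ?A"
      "scale F1 u + scale F1 v \<in> ?A" "scale F1 u + scale F2 v \<in> ?A" "scale F2 u + scale F0 v \<in> ?A"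
      "scale F0 u + scale F2 v \<in> ?A" "scale F2 u + scale F2 v \<in> ?A" "scale F2 u + scale F1 v \<in> ?A"
      by blast+
    then show "?B \<subseteq> ?A" by simp
  qed
  show "x \<noteq> 0 \<Longrightarrow> pnt x \<in> ln4 (u, v) \<longleftrightarrow> x \<in> span2 u v"
    "pnt x \<in> ln4 (u, v) \<Longrightarrow> x \<in> span2 u v"
    unfolding span2_def * by (auto simp: pnt_eq_iff)
qed

lemma span2_closed: "x \<in> span2 u v \<Longrightarrow> y \<in> span2 u v \<Longrightarrow> span2 x y \<subseteq> span2 u v"
proof -
  have sc: "scale a (scale b z) = scale (a * b) z" for a b z
    by (cases z) (simp add: mult.assoc)
  have "\<exists>c d. scale a (scale k u + scale l v) + scale b (scale k' u + scale l' v) = scale c u + scale d v"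
    for a b k l k' l'
    by (rule exI[of _ "a * k + b * k'"], rule exI[of _ "a * l + b * l'"])
      (simp add: scale_add scale_add_left sc add_ac)
  then show "x \<in> span2 u v \<Longrightarrow> y \<in> span2 u v \<Longrightarrow> span2 x y \<subseteq> span2 u v"
    unfolding span2_def by auto
qed

text \<open>The conjugate \<alpha>^3 only changes the sign of the imaginary part, so both span
  conditions coincide and \<open>b\<close> may be taken as 1. What remains is that the line contains
  the real and the imaginary part of P(\<alpha>) as points.\<close>

lemma IC_ln4_iff:
  assumes r: "r \<in> set rrefs"
  shows "IC (ln4 r) \<longleftrightarrow> (\<exists>a. pnt (re_cub a) \<in> ln4 r \<and> pnt (im_cub a F1) \<in> ln4 r)"
proof -
  obtain u v where uv: "r = (u, v)" by force
  have ind: "indep u v" using r indep_rrefs uv by blast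
  have im: "pnt (im_cub a b) = pnt (im_cub a F1)" "im_cub a (- b) = - im_cub a b" if "b \<noteq> F0" for a b
    using that by (cases b; simp add: im_cub_def pnt_eq_iff)+
  have uminus_span: "- x \<in> span2 p q" if "x \<in> span2 p q" for x p q
  proof -
    have "- (scale a p + scale b q) = scale (- a) p + scale (- b) q" for a b
      by (cases a; cases b; simp)
    then show ?thesis using that unfolding span2_def by auto metis
  qed
  have nz: "re_cub a \<noteq> 0" "im_cub a F1 \<noteq> 0" for a
    by (cases a; simp add: re_cub_def im_cub_def zero_vec4_def)+
  have "IC (ln4 r) \<longleftrightarrow> (\<exists>x y a b. x \<noteq> 0 \<and> y \<noteq> 0 \<and> pnt x \<in> ln4 r \<and> pnt y \<in> ln4 r \<and> pnt x \<noteq> pnt y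
      \<and> b \<noteq> F0 \<and> inF9span (emb x) (emb y) (Pc9 (f3_int a, f3_int b))
      \<and> inF9span (emb x) (emb y) (Pc9 (f9pow (f3_int a, f3_int b) 3)))"
    using r unfolding IC_def Lines_eq vecs_eq bex_F9 pnt_def
    by simp
  also have "\<dots> \<longleftrightarrow> (\<exists>x y a b. x \<noteq> 0 \<and> y \<noteq> 0 \<and> pnt x \<in> ln4 r \<and> pnt y \<in> ln4 r \<and> pnt x \<noteq> pnt y
      \<and> b \<noteq> F0 \<and> re_cub a \<in> span2 x y \<and> im_cub a b \<in> span2 x y)"
  proof -
    have "inF9span (emb x) (emb y) (Pc9 (f3_int a, f3_int b))
        \<and> inF9span (emb x) (emb y) (Pc9 (f9pow (f3_int a, f3_int b) 3))
      \<longleftrightarrow> re_cub a \<in> span2 x y \<and> im_cub a b \<in> span2 x y" if "b \<noteq> F0" for x y a b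
      using Pc9_eq[OF that, of a] Pc9_eq(1)[of "- b" a] that im(2)[OF that, of a] uminus_span
      by (auto simp: inF9span_iff)
    then show ?thesis by (simp cong: conj_cong)
  qed
  also have "\<dots> \<longleftrightarrow> (\<exists>a. pnt (re_cub a) \<in> ln4 r \<and> pnt (im_cub a F1) \<in> ln4 r)"
  proof
    assume "\<exists>x y a b. x \<noteq> 0 \<and> y \<noteq> 0 \<and> pnt x \<in> ln4 r \<and> pnt y \<in> ln4 r \<and> pnt x \<noteq> pnt y
      \<and> b \<noteq> F0 \<and> re_cub a \<in> span2 x y \<and> im_cub a b \<in> span2 x y"
    then obtain x y a b where *: "pnt x \<in> ln4 r" "pnt y \<in> ln4 r" "b \<noteq> F0"
      "re_cub a \<in> span2 x y" "im_cub a b \<in> span2 x y" by blast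
    then have "re_cub a \<in> span2 u v" "im_cub a b \<in> span2 u v"
      using pnt_ln4_iff_span2(2)[OF ind] span2_closed unfolding uv by blast+
    moreover have "im_cub a b \<noteq> 0"
      using \<open>b \<noteq> F0\<close> by (simp add: im_cub_def zero_vec4_def)
    ultimately have "pnt (re_cub a) \<in> ln4 r" "pnt (im_cub a b) \<in> ln4 r"
      using pnt_ln4_iff_span2(1)[OF ind] nz unfolding uv by blast+
    then show "\<exists>a. pnt (re_cub a) \<in> ln4 r \<and> pnt (im_cub a F1) \<in> ln4 r"
      using im(1)[OF \<open>b \<noteq> F0\<close>] by metis
  next
    assume "\<exists>a. pnt (re_cub a) \<in> ln4 r \<and> pnt (im_cub a F1) \<in> ln4 r"
    then obtain a where a: "pnt (re_cub a) \<in> ln4 r" "pnt (im_cub a F1) \<in> ln4 r" by blast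
    \<comment> \<open>The first coordinates are 0 and 1. These two points, with
      \<open>b = F1\<close>, serve as the witnesses below.\<close>
    moreover have "pnt (re_cub a) \<noteq> pnt (im_cub a F1)"
      by (simp add: pnt_eq_iff re_cub_def im_cub_def)
    moreover have "x \<in> span2 x y" "y \<in> span2 x y" for x y
    proof -
      have "x = scale F1 x + scale F0 y" "y = scale F0 x + scale F1 y" by simp_all
      then show "x \<in> span2 x y" "y \<in> span2 x y" unfolding span2_def by blast+
    qed
    ultimately show "\<exists>x y a b. x \<noteq> 0 \<and> y \<noteq> 0 \<and> pnt x \<in> ln4 r \<and> pnt y \<in> ln4 r \<and> pnt x \<noteq> pnt y
      \<and> b \<noteq> F0 \<and> re_cub a \<in> span2 x y \<and> im_cub a b \<in> span2 x y"
      using nz by (metis f3.distinct(1))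
  qed
  finally show ?thesis .
qed

lemma set_imag_chords: "set imag_chords = {(normalise (re_cub a), normalise (im_cub a F1)) | a. True}"
proof -
  have "imag_chords = map (\<lambda>a. (normalise (re_cub a), normalise (im_cub a F1))) f3s"
    by (simp add: imag_chords_def f3s_def re_cub_def im_cub_def normalise_def)
  then have "set imag_chords = set (map (\<lambda>a. (normalise (re_cub a), normalise (im_cub a F1))) f3s)"
    by (rule arg_cong)
  then show ?thesis unfolding set_map set_f3s by blast
qed

lemma IC_ln4:
  assumes "r \<in> set rrefs"
  shows "IC (ln4 r) \<longleftrightarrow> imag_rref r"
proof -
  have nz: "re_cub a \<noteq> 0" "im_cub a F1 \<noteq> 0" for a
    by (cases a; simp add: re_cub_def im_cub_def zero_vec4_def)+
  have "on_both r (normalise (re_cub a), normalise (im_cub a F1)) \<longleftrightarrow>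
      pnt (re_cub a) \<in> ln4 r \<and> pnt (im_cub a F1) \<in> ln4 r" for a
    using pnt_in_ln4[OF assms, of "normalise (re_cub a)"] pnt_in_ln4[OF assms, of "normalise (im_cub a F1)"] nz
    by (simp add: on_both_def set_points4 lead_coeff4_normalise)
  moreover have "imag_rref r \<longleftrightarrow> (\<exists>x\<in>set imag_chords. on_both r x)"
    by (cases r) (simp add: list_ex_iff)
  moreover have "\<dots> \<longleftrightarrow> (\<exists>a. on_both r (normalise (re_cub a), normalise (im_cub a F1)))"
    unfolding set_imag_chords by blast
  ultimately show ?thesis by (simp add: IC_ln4_iff[OF assms])
qed

lemma EnG_ln4:
  assumes "r \<in> set rrefs"
  shows "EnG (ln4 r) \<longleftrightarrow> eng_rref r"
  using assms by (auto simp: EnG_def eng_rref_def external_ln4 inter_ArLine IC_ln4 list_all_iff)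

section \<open>Orbits of the critical subgroup\<close>

lemma acts_Mabcd:
  "acts (Mabcd (f3_int a) (f3_int b) (f3_int c) (f3_int d)) (star_quad a b c d)"
  unfolding star_quad_def
  by (rule actsI; cases a; cases b; cases c; cases d; simp add: vmat_expand Mabcd_def zerov_def)

lemma f3_int_det_neq_0:
  "(f3_int a * f3_int d - f3_int b * f3_int c) mod 3 \<noteq> 0 \<longleftrightarrow> a * d - b * c \<noteq> F0"
proof -
  have "f3_int (a * d - b * c) = (f3_int a * f3_int d - f3_int b * f3_int c) mod 3"
    by (simp add: f3_int_diff f3_int_mult mod_simps)
  then show ?thesis using f3_int_eq_0_iff by metis
qed

lemma G3star_eq:
  "G3star = {Mabcd (f3_int a) (f3_int b) (f3_int c) (f3_int d) | a b c d. a * d - b * c \<noteq> F0}"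
  unfolding G3star_def f3_int_range f3_int_det_neq_0[symmetric] by blast

lemma set_star: "set star = {star_quad a b c d | a b c d. a * d - b * c \<noteq> F0}"
  by (auto simp: star_def)

lemma Gorbit_G3star: "Gorbit G3star (ln4 r) = ln4 ` set (star_orbit r)"
proof -
  have "Gorbit G3star (ln4 r) =
      {ln4 (image_pair (star_quad a b c d) r) | a b c d. a * d - b * c \<noteq> F0}"
    unfolding Gorbit_def G3star_eq using proj_image_pair[OF acts_Mabcd] by blast
  also have "\<dots> = ln4 ` set (star_orbit r)"
    unfolding star_orbit_def set_map set_star by blast
  finally show ?thesis .
qed

lemma Gorbit_G3star_rclass:
  "set (star_orbit r) = set (filter P rrefs) \<Longrightarrow> Gorbit G3star (ln4 r) = rclass P"
  by (simp only: Gorbit_G3star rclass_def)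

lemma orbit_classes:
  "UnG1 = rclass (\<lambda>r. wts r = {1,2,3} \<and> \<not> ug_rref r)"
  "UnG2 = rclass (\<lambda>r. wts r = {1,3,4} \<and> \<not> tangent_rref r)"
  "EA2 = rclass (\<lambda>r. wts r = {3} \<and> ea_rref r)"
  "EA3 = rclass (\<lambda>r. wts r = {2,3} \<and> ea_rref r)"
  "EnG3 = rclass (\<lambda>r. wts r = {2,3} \<and> eng_rref r)"
  unfolding UnG1_def UnG2_def EA2_def EA3_def EnG3_def base_lines
  by (intro Gorbit_G3star_rclass set_star_orbit)+

lemma profiles_neq:
  "{2::nat,3} \<noteq> {2,4}" "{2::nat,3} \<noteq> {2,3,4}" "{2::nat,4} \<noteq> {2,3,4}"
  "{3::nat} \<noteq> {2,3}" "{3::nat} \<noteq> {2,3,4}" "{3::nat} \<noteq> {2,4}"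
  by code_simp+

lemma Gorbit_G3star_EnG:
  assumes "r \<in> set rrefs" "eng_rref r" "wts r \<noteq> {2,3}"
  shows "ln4 r \<in> Gorbit G3star (ln4 r)"
    and "Gorbit G3star (ln4 r) \<subseteq> rclass (\<lambda>s. wts s = wts r \<and> eng_rref s)"
    and "card (Gorbit G3star (ln4 r)) = (if wts r = {2,4} then 12 else 24)"
proof -
  define orb where "orb = remdups (star_orbit r)"
  have orb: "Gorbit G3star (ln4 r) = ln4 ` set orb"
    by (simp add: Gorbit_G3star orb_def)
  have "r \<in> set (filter (\<lambda>r. eng_rref r \<and> wts r \<noteq> {2,3}) rrefs)"
    using assms by simp
  then have "eng_orbit r" using eng_orbit_all by blast
  then have *: "length orb = (if wts r = {2,4} then 12 else 24)" "r \<in> set orb"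
    "\<And>s. s \<in> set orb \<Longrightarrow> s \<in> set rrefs \<and> eng_rref s \<and> wts s = wts r"
  proof -
    obtain u v where r: "r = (u, v)" by force
    have "same_class r orb"
      using \<open>eng_orbit r\<close> by (simp only: r eng_orbit.simps orb_def)
    then show "length orb = (if wts r = {2,4} then 12 else 24)" "r \<in> set orb"
      "\<And>s. s \<in> set orb \<Longrightarrow> s \<in> set rrefs \<and> eng_rref s \<and> wts s = wts r"
      unfolding r same_class.simps list_all_iff using is_rref_imp_rrefs by blast+
  qed
  show "ln4 r \<in> Gorbit G3star (ln4 r)" using * orb by blast
  show "Gorbit G3star (ln4 r) \<subseteq> rclass (\<lambda>s. wts s = wts r \<and> eng_rref s)"
    using *(3) unfolding orb rclass_def by (intro image_mono) (simp add: subset_iff)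
  have "card (ln4 ` set orb) = card (set orb)"
    by (intro card_image inj_on_subset[OF inj_on_ln4]) (use *(3) in blast)
  also have "\<dots> = length orb" by (rule distinct_card) (simp add: orb_def)
  finally show "card (Gorbit G3star (ln4 r)) = (if wts r = {2,4} then 12 else 24)"
    unfolding orb *(1)[symmetric] .
qed

text \<open>Each line lies in its own orbit, the orbit stays inside one weight class, and its size
  tells which class. Hence the union of all orbits of size \<open>n\<close> is the whole class
  \<open>A\<close>.\<close>

lemma EnG_orbits:
  assumes "A \<noteq> {2,3}"
    and card: "\<And>r. r \<in> set rrefs \<Longrightarrow> eng_rref r \<Longrightarrow> wts r \<noteq> {2,3} \<Longrightarrow>
      card (Gorbit G3star (ln4 r)) = n \<longleftrightarrow> wts r = A"
  shows "\<Union>{Ob. \<exists>L. EnG L \<and> L \<notin> EnG3 \<and> Ob = Gorbit G3star L \<and> card Ob = n} =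
    rclass (\<lambda>r. wts r = A \<and> eng_rref r)" (is "\<Union>?X = _")
proof
  show "\<Union>?X \<subseteq> rclass (\<lambda>r. wts r = A \<and> eng_rref r)"
  proof
    fix K assume "K \<in> \<Union>?X"
    then obtain L where L: "EnG L" "L \<notin> EnG3" "K \<in> Gorbit G3star L" "card (Gorbit G3star L) = n"
      by blast
    have "L \<in> Lines" using L(1) by (simp add: EnG_def external_def)
    then obtain r where r: "r \<in> set rrefs" "L = ln4 r" by (auto simp: Lines_eq)
    then have e: "eng_rref r" "wts r \<noteq> {2,3}"
      using L by (auto simp: EnG_ln4 orbit_classes in_rclass)
    then show "K \<in> rclass (\<lambda>r. wts r = A \<and> eng_rref r)"
      using Gorbit_G3star_EnG(2)[OF r(1) e] card[OF r(1) e] L r by auto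
  qed
  show "rclass (\<lambda>r. wts r = A \<and> eng_rref r) \<subseteq> \<Union>?X"
  proof
    fix L assume "L \<in> rclass (\<lambda>r. wts r = A \<and> eng_rref r)"
    then obtain r where r: "r \<in> set rrefs" "wts r = A" "eng_rref r" "L = ln4 r"
      by (auto simp: rclass_def)
    then have "EnG L" "L \<notin> EnG3" "L \<in> Gorbit G3star L" "card (Gorbit G3star L) = n"
      using card assms(1) Gorbit_G3star_EnG(1) by (auto simp: EnG_ln4 orbit_classes in_rclass)
    then show "L \<in> \<Union>?X" by blast
  qed
qed

lemma eng_profile:
  "r \<in> set rrefs \<Longrightarrow> eng_rref r \<Longrightarrow> wts r \<noteq> {2,3} \<Longrightarrow> wts r = {2,4} \<or> wts r = {2,3,4}"
  using rref_profiles(6) by auto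

lemma EnG2_eq: "EnG2 = rclass (\<lambda>r. wts r = {2,4} \<and> eng_rref r)"
  unfolding EnG2_def
  by (rule EnG_orbits) (use profiles_neq in \<open>auto simp: Gorbit_G3star_EnG(3)\<close>)

lemma EnG1_eq: "EnG1 = rclass (\<lambda>r. wts r = {2,3,4} \<and> eng_rref r)"
  unfolding EnG1_def
  by (rule EnG_orbits) (use profiles_neq eng_profile in \<open>auto simp: Gorbit_G3star_EnG(3)\<close>)

lemma type_classes:
  "{L. RC L} = rclass (\<lambda>r. 2 \<le> ncub r)"
  "{L. Tr L} = rclass tangent_rref"
  "{L. IC L} = rclass imag_rref"
  "{L. UG L} = rclass ug_rref"
  "{L. EA L} = rclass ea_rref"
  by (rule rclass_eqI, simp add: RC_def Tr_def IC_def UG_def unisecant_def EA_def external_def,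
      simp add: RC_ln4 Tr_ln4 IC_ln4 UG_ln4 EA_ln4)+

lemma EA1_eq: "EA1 = rclass (\<lambda>r. wts r = {2,3,4} \<and> ea_rref r)"
  unfolding EA1_def type_classes orbit_classes rclass_Diff
proof (rule rclass_cong)
  fix r assume "r \<in> set rrefs"
  then have "ea_rref r \<longrightarrow> wts r = {3} \<or> wts r = {2,3} \<or> wts r = {2,3,4}"
    using rref_profiles(5) by auto
  then show "(ea_rref r \<and> \<not> (wts r = {3} \<and> ea_rref r)) \<and> \<not> (wts r = {2,3} \<and> ea_rref r)
      \<longleftrightarrow> wts r = {2,3,4} \<and> ea_rref r"
    using profiles_neq by metis
qed

lemma ArLine_class: "{ArLine} = rclass (\<lambda>r. r = ar_rref)"
  using ar_rref_in_rrefs by (auto simp: ArLine_eq rclass_def)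

section \<open>The seven weight classes as orbits\<close>

definition wclass where
  "wclass A = rclass (\<lambda>r. wts r = A)"

lemma LineOrbits_G3: "LineOrbits G3 = wclass ` set profiles"
proof -
  have "LineOrbits G3 = (\<lambda>r. Gorbit G3 (ln4 r)) ` set rrefs"
    by (auto simp: LineOrbits_def Lines_eq)
  also have "\<dots> = wclass ` wts ` set rrefs"
    by (auto simp: Gorbit_G3 wclass_def)
  also have "wts ` set rrefs = set profiles"
  proof -
    have "set reps \<subseteq> set rrefs" using reps_rrefs is_rref_imp_rrefs by blast
    then have "set profiles \<subseteq> wts ` set rrefs"
      unfolding wts_reps[symmetric] by auto
    then show ?thesis using wts_in_profiles by blast
  qed
  finally show ?thesis .
qed

text \<open>Every class contains its representative from \<open>reps\<close> and is therefore
  nonempty, so it determines its weight set.\<close>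

lemma inj_on_wclass: "inj_on wclass (set profiles)"
proof (rule inj_onI)
  fix A B assume *: "A \<in> set profiles" "B \<in> set profiles" "wclass A = wclass B"
  obtain t where t: "t \<in> set reps" "wts t = A"
    using *(1) unfolding wts_reps[symmetric] by auto
  then have "t \<in> set rrefs" using reps_rrefs is_rref_imp_rrefs by blast
  then show "A = B"
    using * t in_rclass[of t] unfolding wclass_def by metis
qed

lemma wclass_eqs:
  "{L. RC L} = wclass {1,2}"
  "EnG2 = wclass {2,4}"
  "{L. Tr L} \<union> UnG2 = wclass {1,3,4}"
  "{L. IC L} \<union> {ArLine} \<union> EA2 = wclass {3}"
  "{L. UG L} \<union> UnG1 = wclass {1,2,3}"
  "EA1 \<union> EnG1 = wclass {2,3,4}"
  "EA3 \<union> EnG3 = wclass {2,3}"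
proof -
  have ar: "r = ar_rref \<longrightarrow> wts r = {3}" for r using rref_profiles(10) by simp
  have ea_eng: "wts r = {2,3,4} \<or> wts r = {2,3} \<longrightarrow> ea_rref r \<or> eng_rref r" if "r \<in> set rrefs" for r
    using rref_profiles(9) that by simp
  note classes = wclass_def type_classes orbit_classes EnG2_eq EnG1_eq EA1_eq ArLine_class rclass_Un
  show "{L. RC L} = wclass {1,2}"
    unfolding classes by (rule rclass_cong) (rule bspec[OF rref_profiles(1)])
  show "EnG2 = wclass {2,4}"
    unfolding classes by (rule rclass_cong) (use rref_profiles(7) in metis)
  show "{L. Tr L} \<union> UnG2 = wclass {1,3,4}"
    unfolding classes by (rule rclass_cong) (use rref_profiles(2) in metis)
  show "{L. IC L} \<union> {ArLine} \<union> EA2 = wclass {3}"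
    unfolding classes by (rule rclass_cong) (use rref_profiles(3,8) ar in metis)
  show "{L. UG L} \<union> UnG1 = wclass {1,2,3}"
    unfolding classes by (rule rclass_cong) (use rref_profiles(4) in metis)
  show "EA1 \<union> EnG1 = wclass {2,3,4}"
    unfolding classes by (rule rclass_cong) (use ea_eng in metis)
  show "EA3 \<union> EnG3 = wclass {2,3}"
    unfolding classes by (rule rclass_cong) (use ea_eng in metis)
qed

theorem theorem5p4:
  defines "L1 \<equiv> {L. RC L}"
      and "L2 \<equiv> EnG2"
      and "L3 \<equiv> {L. Tr L} \<union> UnG2"
      and "L4 \<equiv> {L. IC L} \<union> {ArLine} \<union> EA2"
      and "L5 \<equiv> {L. UG L} \<union> UnG1"
      and "L6 \<equiv> EA1 \<union> EnG1"
      and "L7 \<equiv> EA3 \<union> EnG3"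
  shows "LineOrbits G3 = {L1, L2, L3, L4, L5, L6, L7}
       \<and> card (LineOrbits G3) = 7
       \<and> card L1 = 6
       \<and> card L2 = 12
       \<and> card {L. Tr L} = 4 \<and> card UnG2 = 12 \<and> card L3 = 16
       \<and> card {L. IC L} = 3 \<and> card EA2 = 4 \<and> card L4 = 8
       \<and> card {L. UG L} = 12 \<and> card UnG1 = 12 \<and> card L5 = 24
       \<and> card EA1 = 24 \<and> card EnG1 = 24 \<and> card L6 = 48
       \<and> card EA3 = 4 \<and> card EnG3 = 12 \<and> card L7 = 16"
proof -
  note L = L1_def L2_def L3_def L4_def L5_def L6_def L7_def
  have "LineOrbits G3 = {L1, L2, L3, L4, L5, L6, L7}"
    unfolding LineOrbits_G3 L wclass_eqs by (simp add: profiles_def)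
  moreover have "card (LineOrbits G3) = 7"
    unfolding LineOrbits_G3 card_image[OF inj_on_wclass] distinct_card[OF distinct_profiles]
    by (simp add: profiles_def)
  moreover have "card L1 = 6 \<and> card L2 = 12 \<and> card L3 = 16 \<and> card L4 = 8 \<and> card L5 = 24
      \<and> card L6 = 48 \<and> card L7 = 16"
    using card_profiles unfolding L wclass_eqs wclass_def card_rclass by (simp add: profiles_def)
  moreover have "card {L. Tr L} = 4 \<and> card UnG2 = 12 \<and> card {L. IC L} = 3 \<and> card EA2 = 4
      \<and> card {L. UG L} = 12 \<and> card UnG1 = 12 \<and> card EA1 = 24 \<and> card EnG1 = 24
      \<and> card EA3 = 4 \<and> card EnG3 = 12"
    using card_subclasses
    unfolding type_classes orbit_classes EnG1_eq EA1_eq card_rclass by simp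
  ultimately show ?thesis by blast
qed

end
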